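(* Let $\mathcal{X}_{+},\mathcal{X}_{-}$ be real normed spaces, $K$ a compact convex Hausdorff space, $\tau_{\pm}:K\to\mathcal{X}_{\pm}$ two continuous affine maps and $f:K\to\{-\infty\}\cup\mathbb{R}$ an upper semicontinuous concave function that is not identically $-\infty$. Let $g_{-}:\mathcal{X}_{-}\to\mathbb{R}$ be lower semicontinuous and convex, such that there is $R_{0}\in\mathbb{R}^{+}$ for which $B_{-}(0,R)\cap\mathrm{dom}(g_{-}^{\ast})$ is nonempty and weak$^{\ast}$-closed for all $R\in[R_{0},\infty)$, and such that $g_{-}^{\ast}$ has minimal linear growth $\Vert\tau_{-}\Vert_{\infty}$. Let $g_{+}:\mathcal{X}_{+}\to\mathbb{R}$ be lower semicontinuous, convex and bounded on bounded sets, such that $\mathrm{dom}(g_{+}^{\ast})=\mathcal{X}_{+}^{\ast}$ and $g_{+}^{\ast}$ has minimal linear growth $\Vert\tau_{+}\Vert_{\infty}$. Let $\mathbb{F}:=f-g_{-}\circ\tau_{-}+g_{+}\circ\tau_{+}$. Then: (i) $\displaystyle \sup\mathbb{F}(K)=\mathrm{P}^{\flat}=\sup_{y_{+}\in\mathcal{X}_{+}^{\ast}}\inf_{y_{-}\in\mathcal{X}_{-}^{\ast}}P_{\mathrm{NL}}(y_{+},y_{-})\in\mathbb{R}$. (ii) For any $x_{+}\in\mathrm{M}^{\flat}$ and $x_{-}\in M^{\flat}(x_{+})$, the set $$E^{\mathrm{sc}}_{\mathcal{G}_{x_{+},x_{-}}}:=\{\nu\in E_{\mathcal{G}_{x_{+},x_{-}}}: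 x_{-}\in\partial g_{-}(\tau_{-}(\nu))\}$$ is nonempty, convex and compact, and does not depend on the choice of $x_{-}\in M^{\flat}(x_{+})$; denote it by $E^{\mathrm{sc}}_{\mathcal{G}_{x_{+},\cdot}}$. Furthermore, for all $x_{+}\in\mathrm{M}^{\flat}$, $$E^{\mathrm{sc}}_{\mathcal{G}_{x_{+},\cdot}}\subseteq\{\nu\in K: x_{+}\in\partial g_{+}(\tau_{+}(\nu))\}.$$ (iii) $E_{\mathbb{F}}=M_{\mathbb{F}}$, this set is compact, and $$E_{\mathbb{F}}=M_{\mathbb{F}}=\bigcup_{x_{+}\in\mathrm{M}^{\flat}}E^{\mathrm{sc}}_{\mathcal{G}_{x_{+},\cdot}}.$$ If $g_{+}$ is additionally Gateaux-differentiable, then this union is disjoint. (iv) If $f$ is affine and, for all $x_{\pm}\in\mathcal{X}_{\pm}^{\ast}$, $\mathcal{G}_{x_{+},x_{-}}$ has one single maximizer over $K$ (i.e. $E_{\mathcal{G}_{x_{+},x_{-}}}$ is a singleton), then $E_{\mathbb{F}}=M_{\mathbb{F}}$ is a subset of the extreme points of $K$.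
   Context: A compact convex Hausdorff space is a nonempty compact convex subset of a real Hausdorff topological vector space. $\mathbb{R}^{+}=(0,\infty)$. For a real normed space $\mathcal{X}$, $\mathcal{X}^{\ast}$ is its topological dual, endowed with the weak$^{\ast}$ topology, $\Vert\cdot\Vert_{\mathrm{op}}$ is the dual (operator) norm, and $B(0,R)=\{y\in\mathcal{X}^{\ast}:\Vert y\Vert_{\mathrm{op}}\le R\}$; $B_{\pm}(0,R)$ denote these balls in $\mathcal{X}_{\pm}^{\ast}$. For $g:\mathcal{X}\to\mathbb{R}$ the Legendre-Fenchel transform is $g^{\ast}(x)=\sup_{y\in\mathcal{X}}\{x(y)-g(y)\}\in(-\infty,\infty]$, $x\in\mathcal{X}^{\ast}$; $\mathrm{dom}(g^{\ast})=\{x\in\mathcal{X}^{\ast}:g^{\ast}(x)<\infty\}$. The subdifferential at $z\in\mathcal{X}$ is $\partial g(z)=\{x\in\mathcal{X}^{\ast}: x(y-z)\le g(y)-g(z)\ \forall y\in\mathcal{X}\}$. $g^{\ast}$ has minimal linear growth $\lambda$ if $\lim_{R\to\infty}\sup_{y\in\mathcal{X}^{\ast}\setminus B(0,R)}\{\lambda\Vert y\Vert_{\mathrm{op}}-g^{\ast}(y)\}=-\infty$. $\Vert\tau_{\pm}\Vert_{\infty}=\sup_{\mu\in K}\Vert\tau_{\pm}(\mu)\Vert_{\mathcal{X}_{\pm}}$. For $y_{\pm}\in\mathcal{X}_{\pm}^{\ast}$ set: $\mathcal{G}_{y_{+},y_{-}}=f-y_{-}\circ\tau_{-}+y_{+}\circ\tau_{+}$;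 $E_{\mathcal{G}_{y_{+},y_{-}}}=\{\mu\in K:\mathcal{G}_{y_{+},y_{-}}(\mu)=\sup\mathcal{G}_{y_{+},y_{-}}(K)\}$; $P_{\mathrm{L}}(y_{+},y_{-})=\sup\mathcal{G}_{y_{+},y_{-}}(K)$; $P_{\mathrm{NL}}(y_{+},y_{-})=P_{\mathrm{L}}(y_{+},y_{-})+g_{-}^{\ast}(y_{-})-g_{+}^{\ast}(y_{+})$; $P^{\flat}(y_{+})=\inf_{y_{-}\in\mathcal{X}_{-}^{\ast}}P_{\mathrm{NL}}(y_{+},y_{-})$; $\mathrm{P}^{\flat}=\sup_{y_{+}\in\mathcal{X}_{+}^{\ast}}P^{\flat}(y_{+})$; $\mathrm{M}^{\flat}=\{x_{+}\in\mathcal{X}_{+}^{\ast}:P^{\flat}(x_{+})=\mathrm{P}^{\flat}\}$; $M^{\flat}(y_{+})=\{x_{-}\in\mathcal{X}_{-}^{\ast}:P_{\mathrm{NL}}(y_{+},x_{-})=P^{\flat}(y_{+})\}$. $M_{\mathbb{F}}=\{\mu\in K:\mathbb{F}(\mu)=\sup\mathbb{F}(K)\}$ and $E_{\mathbb{F}}=\{\mu\in K:\exists$ a net $(\mu_{j})_{j\in J}\subseteq K$ with $\lim_{J}\mu_{j}=\mu$ and $\lim_{J}\mathbb{F}(\mu_{j})=\sup\mathbb{F}(K)\}$. *)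

theory Defs
  imports "HOL-Analysis.Analysis"
begin

section \<open>Real topological vector spaces\<close>

class real_tvs = real_vector + topological_ab_group_add +
  assumes tendsto_scaleR_nhds:
    "((\<lambda>p. fst p *\<^sub>R snd p) \<longlongrightarrow> c *\<^sub>R x) (nhds c \<times>\<^sub>F nhds x)"

instance real_normed_vector \<subseteq> real_tvs
proof
  fix c :: real and x :: 'a
  show "((\<lambda>p. fst p *\<^sub>R snd p) \<longlongrightarrow> c *\<^sub>R x) (nhds c \<times>\<^sub>F nhds x)"
    by (intro tendsto_scaleR filterlim_fst filterlim_snd)
qed

section \<open>Affine, concave and semicontinuous functions\<close>

definition affine_map_on :: "'v::real_vector set \<Rightarrow> ('v \<Rightarrow> 'a::real_vector) \<Rightarrow> bool" where
  "affine_map_on K \<tau> \<longleftrightarrow>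
    (\<forall>x\<in>K. \<forall>y\<in>K. \<forall>t\<in>{0..1}. \<tau> ((1 - t) *\<^sub>R x + t *\<^sub>R y) = (1 - t) *\<^sub>R \<tau> x + t *\<^sub>R \<tau> y)"

text \<open>The next two notions are meant for functions that do not take the value \<open>\<infinity>\<close> on \<open>K\<close>; they use
  that \<open>0 * (-\<infinity>) = 0\<close> for extended reals, so that the cases \<open>t = 0\<close> and \<open>t = 1\<close> are trivial.\<close>

definition ereal_concave_on :: "'v::real_vector set \<Rightarrow> ('v \<Rightarrow> ereal) \<Rightarrow> bool" where
  "ereal_concave_on K f \<longleftrightarrow>
    (\<forall>x\<in>K. \<forall>y\<in>K. \<forall>t\<in>{0..1}.
      ereal (1 - t) * f x + ereal t * f y \<le> f ((1 - t) *\<^sub>R x + t *\<^sub>R y))"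

definition ereal_affine_on :: "'v::real_vector set \<Rightarrow> ('v \<Rightarrow> ereal) \<Rightarrow> bool" where
  "ereal_affine_on K f \<longleftrightarrow>
    (\<forall>x\<in>K. \<forall>y\<in>K. \<forall>t\<in>{0..1}.
      f ((1 - t) *\<^sub>R x + t *\<^sub>R y) = ereal (1 - t) * f x + ereal t * f y)"

definition upper_semicontinuous_on :: "'a::topological_space set \<Rightarrow> ('a \<Rightarrow> 'b::linorder) \<Rightarrow> bool" where
  "upper_semicontinuous_on S f \<longleftrightarrow> (\<forall>x\<in>S. \<forall>a>f x. \<forall>\<^sub>F y in at x within S. f y < a)"

definition lower_semicontinuous_on :: "'a::topological_space set \<Rightarrow> ('a \<Rightarrow> 'b::linorder) \<Rightarrow> bool" where
  "lower_semicontinuous_on S f \<longleftrightarrow> (\<forall>x\<in>S. \<forall>a<f x. \<forall>\<^sub>F y in at x within S. a < f y)"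

section \<open>Duals and convex analysis\<close>

text \<open>The dual of a real normed space is the type of bounded linear functionals, normed by the
  operator norm. For scalar-valued operators the strong operator topology, i.e. the topology of
  pointwise convergence, is the weak\<open>*\<close> topology.\<close>

type_synonym 'a dual = "'a \<Rightarrow>\<^sub>L real"

abbreviation weak_star_topology :: "'a::real_normed_vector dual topology" where
  "weak_star_topology \<equiv> strong_operator_topology"

definition legendre_fenchel :: "('a::real_normed_vector \<Rightarrow> real) \<Rightarrow> 'a dual \<Rightarrow> ereal" where
  "legendre_fenchel g x = (SUP y. ereal (blinfun_apply x y - g y))"

definition effective_domain :: "('a \<Rightarrow> ereal) \<Rightarrow> 'a set" where
  "effective_domain h = {x. h x < \<infinity>}"

definition subdifferential ::
    "('a::real_normed_vector \<Rightarrow> real) \<Rightarrow> 'a \<Rightarrow> 'a dual set" where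
  "subdifferential g z = {x. \<forall>y. blinfun_apply x (y - z) \<le> g y - g z}"

definition minimal_linear_growth :: "('a::real_normed_vector dual \<Rightarrow> ereal) \<Rightarrow> real \<Rightarrow> bool" where
  "minimal_linear_growth h l \<longleftrightarrow>
    ((\<lambda>R. SUP y\<in>- cball 0 R. ereal (l * norm y) - h y) \<longlongrightarrow> -\<infinity>) at_top"

definition sup_norm_on :: "'v set \<Rightarrow> ('v \<Rightarrow> 'a::real_normed_vector) \<Rightarrow> real" where
  "sup_norm_on K \<tau> = (SUP \<mu>\<in>K. norm (\<tau> \<mu>))"

definition gateaux_differentiable :: "('a::real_normed_vector \<Rightarrow> real) \<Rightarrow> bool" where
  "gateaux_differentiable g \<longleftrightarrow>
    (\<forall>z. \<exists>D :: 'a dual. \<forall>h. ((\<lambda>t. (g (z + t *\<^sub>R h) - g z) / t) \<longlongrightarrow> blinfun_apply D h) (at 0))"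

section \<open>Nets and generalized maximizers\<close>

definition directed_set :: "'j set \<Rightarrow> ('j \<Rightarrow> 'j \<Rightarrow> bool) \<Rightarrow> bool" where
  "directed_set J le \<longleftrightarrow> J \<noteq> {} \<and> (\<forall>i\<in>J. le i i) \<and>
    (\<forall>i\<in>J. \<forall>j\<in>J. \<forall>k\<in>J. le i j \<longrightarrow> le j k \<longrightarrow> le i k) \<and>
    (\<forall>i\<in>J. \<forall>j\<in>J. \<exists>k\<in>J. le i k \<and> le j k)"

text \<open>The filter of tails: a net \<open>m\<close> indexed by \<open>(J, le)\<close> has limit \<open>x\<close> iff
  \<open>(m \<longlongrightarrow> x) (net_filter J le)\<close>.\<close>

definition net_filter :: "'j set \<Rightarrow> ('j \<Rightarrow> 'j \<Rightarrow> bool) \<Rightarrow> 'j filter" where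
  "net_filter J le = (INF i\<in>J. principal {j\<in>J. le i j})"

definition maximizers :: "'v set \<Rightarrow> ('v \<Rightarrow> ereal) \<Rightarrow> 'v set" where
  "maximizers K h = {\<mu>\<in>K. h \<mu> = (SUP \<nu>\<in>K. h \<nu>)}"

text \<open>One cannot quantify over the type of the index set of a net inside a formula. The index type
  \<open>'v set \<times> 'v\<close> is large enough to obtain the limits of nets with arbitrary index types,
  see \<open>generalized_maximizersI\<close> below.\<close>

definition generalized_maximizers :: "'v::topological_space set \<Rightarrow> ('v \<Rightarrow> ereal) \<Rightarrow> 'v set" where
  "generalized_maximizers K h =
    {\<mu>\<in>K. \<exists>(J :: ('v set \<times> 'v) set) le m. directed_set J le \<and> m ` J \<subseteq> K \<and>
      (m \<longlongrightarrow> \<mu>) (net_filter J le) \<and>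
      ((\<lambda>j. h (m j)) \<longlongrightarrow> (SUP \<nu>\<in>K. h \<nu>)) (net_filter J le)}"

lemma eventually_net_filter:
  assumes "directed_set J le"
  shows "eventually P (net_filter J le) \<longleftrightarrow> (\<exists>i\<in>J. \<forall>j\<in>J. le i j \<longrightarrow> P j)"
proof -
  have "eventually P (net_filter J le) \<longleftrightarrow>
      (\<exists>i\<in>J. eventually P (principal {j\<in>J. le i j}))"
    unfolding net_filter_def
  proof (rule eventually_INF_base)
    show "J \<noteq> {}" using assms by (simp add: directed_set_def)
    fix a b assume "a \<in> J" "b \<in> J"
    then obtain c where c: "c \<in> J" "le a c" "le b c"
      using assms unfolding directed_set_def by blast
    then have "{j\<in>J. le c j} \<subseteq> {j\<in>J. le a j} \<inter> {j\<in>J. le b j}"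
      using assms \<open>a \<in> J\<close> \<open>b \<in> J\<close> unfolding directed_set_def by blast
    then show "\<exists>x\<in>J. principal {j\<in>J. le x j} \<le>
        inf (principal {j\<in>J. le a j}) (principal {j\<in>J. le b j})"
      using c(1) by auto
  qed
  then show ?thesis by (auto simp: eventually_principal)
qed

lemma generalized_maximizersI:
  fixes J :: "'j set" and K :: "'v::topological_space set"
  assumes dir: "directed_set J le" and mK: "m ` J \<subseteq> K" and "\<mu> \<in> K"
    and lim: "(m \<longlongrightarrow> \<mu>) (net_filter J le)"
    and limh: "((\<lambda>j. h (m j)) \<longlongrightarrow> (SUP \<nu>\<in>K. h \<nu>)) (net_filter J le)"
  shows "\<mu> \<in> generalized_maximizers K h"
proof -
  let ?ev = "\<lambda>A. \<forall>\<^sub>F j in net_filter J le. m j \<in> A"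
  define J' where "J' = {(A, x). ?ev A \<and> x \<in> A \<and> x \<in> K}"
  define le' :: "'v set \<times> 'v \<Rightarrow> 'v set \<times> 'v \<Rightarrow> bool"
    where "le' = (\<lambda>p q. fst q \<subseteq> fst p)"
  have ne: "\<exists>x. x \<in> A \<and> x \<in> K" if "?ev A" for A
    using that mK dir unfolding eventually_net_filter[OF dir] directed_set_def by blast
  have dir': "directed_set J' le'"
    unfolding directed_set_def
  proof (intro conjI)
    have ev: "?ev UNIV" by simp
    from ne[OF this] obtain x where "x \<in> K" by blast
    with ev have "(UNIV, x) \<in> J'" unfolding J'_def by blast
    then show "J' \<noteq> {}" by blast
    show "\<forall>i\<in>J'. \<forall>j\<in>J'. \<exists>k\<in>J'. le' i k \<and> le' j k"
    proof (intro ballI)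
      fix i j assume "i \<in> J'" "j \<in> J'"
      then have ev: "?ev (fst i \<inter> fst j)"
        unfolding J'_def by (auto intro: eventually_conj)
      from ne[OF this] obtain x where "x \<in> fst i \<inter> fst j" "x \<in> K" by blast
      with ev have "(fst i \<inter> fst j, x) \<in> J'" unfolding J'_def by blast
      then show "\<exists>k\<in>J'. le' i k \<and> le' j k"
        by (rule bexI[rotated]) (simp add: le'_def)
    qed
  qed (auto simp: le'_def)
  have transfer: "eventually (\<lambda>p. P (snd p)) (net_filter J' le')"
    if "eventually (\<lambda>j. P (m j)) (net_filter J le)" for P
  proof -
    from that have ev: "?ev {x. P x}" by simp
    from ne[OF this] obtain x where "P x" "x \<in> K" by blast
    with ev have "({x. P x}, x) \<in> J'" unfolding J'_def by blast
    moreover have "\<forall>q\<in>J'. le' ({x. P x}, x) q \<longrightarrow> P (snd q)"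
      unfolding J'_def le'_def by auto
    ultimately show ?thesis unfolding eventually_net_filter[OF dir'] by blast
  qed
  have "snd ` J' \<subseteq> K" unfolding J'_def by auto
  moreover have "(snd \<longlongrightarrow> \<mu>) (net_filter J' le')"
    using lim unfolding tendsto_def by (auto intro: transfer)
  moreover have "((\<lambda>j. h (snd j)) \<longlongrightarrow> (SUP \<nu>\<in>K. h \<nu>)) (net_filter J' le')"
    unfolding tendsto_def
  proof (intro allI impI)
    fix S assume "open S" "(SUP \<nu>\<in>K. h \<nu>) \<in> S"
    with limh have "\<forall>\<^sub>F j in net_filter J le. h (m j) \<in> S"
      unfolding tendsto_def by blast
    then show "\<forall>\<^sub>F j in net_filter J' le'. h (snd j) \<in> S"
      by (rule transfer)
  qed
  ultimately show ?thesis
    using \<open>\<mu> \<in> K\<close> dir' unfolding generalized_maximizers_def by blast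
qed

section \<open>The nonlinear functional and its approximation\<close>

text \<open>The suffixes \<open>p\<close> and \<open>m\<close> stand for the indices \<open>+\<close> and \<open>-\<close>.\<close>

definition F_nl :: "('v \<Rightarrow> ereal) \<Rightarrow> ('v \<Rightarrow> 'p) \<Rightarrow> ('v \<Rightarrow> 'm) \<Rightarrow> ('p \<Rightarrow> real) \<Rightarrow> ('m \<Rightarrow> real) \<Rightarrow>
    'v \<Rightarrow> ereal" where
  "F_nl f \<tau>p \<tau>m gp gm \<mu> = f \<mu> - ereal (gm (\<tau>m \<mu>)) + ereal (gp (\<tau>p \<mu>))"

definition G_lin :: "('v \<Rightarrow> ereal) \<Rightarrow> ('v \<Rightarrow> 'p::real_normed_vector) \<Rightarrow>
    ('v \<Rightarrow> 'm::real_normed_vector) \<Rightarrow> 'p dual \<Rightarrow> 'm dual \<Rightarrow> 'v \<Rightarrow> ereal" where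
  "G_lin f \<tau>p \<tau>m yp ym \<mu> =
    f \<mu> - ereal (blinfun_apply ym (\<tau>m \<mu>)) + ereal (blinfun_apply yp (\<tau>p \<mu>))"

definition P_L :: "'v set \<Rightarrow> ('v \<Rightarrow> ereal) \<Rightarrow> ('v \<Rightarrow> 'p::real_normed_vector) \<Rightarrow>
    ('v \<Rightarrow> 'm::real_normed_vector) \<Rightarrow> 'p dual \<Rightarrow> 'm dual \<Rightarrow> ereal" where
  "P_L K f \<tau>p \<tau>m yp ym = (SUP \<mu>\<in>K. G_lin f \<tau>p \<tau>m yp ym \<mu>)"

definition P_NL :: "'v set \<Rightarrow> ('v \<Rightarrow> ereal) \<Rightarrow> ('v \<Rightarrow> 'p::real_normed_vector) \<Rightarrow>
    ('v \<Rightarrow> 'm::real_normed_vector) \<Rightarrow> ('p \<Rightarrow> real) \<Rightarrow> ('m \<Rightarrow> real) \<Rightarrow>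
    'p dual \<Rightarrow> 'm dual \<Rightarrow> ereal" where
  "P_NL K f \<tau>p \<tau>m gp gm yp ym =
    P_L K f \<tau>p \<tau>m yp ym + legendre_fenchel gm ym - legendre_fenchel gp yp"

definition P_flat :: "'v set \<Rightarrow> ('v \<Rightarrow> ereal) \<Rightarrow> ('v \<Rightarrow> 'p::real_normed_vector) \<Rightarrow>
    ('v \<Rightarrow> 'm::real_normed_vector) \<Rightarrow> ('p \<Rightarrow> real) \<Rightarrow> ('m \<Rightarrow> real) \<Rightarrow> 'p dual \<Rightarrow> ereal" where
  "P_flat K f \<tau>p \<tau>m gp gm yp = (INF ym. P_NL K f \<tau>p \<tau>m gp gm yp ym)"

definition P_flat_sup :: "'v set \<Rightarrow> ('v \<Rightarrow> ereal) \<Rightarrow> ('v \<Rightarrow> 'p::real_normed_vector) \<Rightarrow>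
    ('v \<Rightarrow> 'm::real_normed_vector) \<Rightarrow> ('p \<Rightarrow> real) \<Rightarrow> ('m \<Rightarrow> real) \<Rightarrow> ereal" where
  "P_flat_sup K f \<tau>p \<tau>m gp gm = (SUP yp. P_flat K f \<tau>p \<tau>m gp gm yp)"

definition M_flat_sup :: "'v set \<Rightarrow> ('v \<Rightarrow> ereal) \<Rightarrow> ('v \<Rightarrow> 'p::real_normed_vector) \<Rightarrow>
    ('v \<Rightarrow> 'm::real_normed_vector) \<Rightarrow> ('p \<Rightarrow> real) \<Rightarrow> ('m \<Rightarrow> real) \<Rightarrow> 'p dual set" where
  "M_flat_sup K f \<tau>p \<tau>m gp gm =
    {xp. P_flat K f \<tau>p \<tau>m gp gm xp = P_flat_sup K f \<tau>p \<tau>m gp gm}"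

definition M_flat :: "'v set \<Rightarrow> ('v \<Rightarrow> ereal) \<Rightarrow> ('v \<Rightarrow> 'p::real_normed_vector) \<Rightarrow>
    ('v \<Rightarrow> 'm::real_normed_vector) \<Rightarrow> ('p \<Rightarrow> real) \<Rightarrow> ('m \<Rightarrow> real) \<Rightarrow> 'p dual \<Rightarrow> 'm dual set" where
  "M_flat K f \<tau>p \<tau>m gp gm yp =
    {xm. P_NL K f \<tau>p \<tau>m gp gm yp xm = P_flat K f \<tau>p \<tau>m gp gm yp}"

definition E_sc :: "'v set \<Rightarrow> ('v \<Rightarrow> ereal) \<Rightarrow> ('v \<Rightarrow> 'p::real_normed_vector) \<Rightarrow>
    ('v \<Rightarrow> 'm::real_normed_vector) \<Rightarrow> ('m \<Rightarrow> real) \<Rightarrow> 'p dual \<Rightarrow> 'm dual \<Rightarrow> 'v set" where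
  "E_sc K f \<tau>p \<tau>m gm xp xm =
    {\<nu> \<in> maximizers K (G_lin f \<tau>p \<tau>m xp xm). xm \<in> subdifferential gm (\<tau>m \<nu>)}"

text \<open>The common value of \<open>E_sc K f \<tau>p \<tau>m gm xp xm\<close> for all \<open>xm \<in> M_flat K f \<tau>p \<tau>m gp gm xp\<close>;
  that it does not depend on \<open>xm\<close> is part of the theorem.\<close>

definition E_sc_common :: "'v set \<Rightarrow> ('v \<Rightarrow> ereal) \<Rightarrow> ('v \<Rightarrow> 'p::real_normed_vector) \<Rightarrow>
    ('v \<Rightarrow> 'm::real_normed_vector) \<Rightarrow> ('p \<Rightarrow> real) \<Rightarrow> ('m \<Rightarrow> real) \<Rightarrow> 'p dual \<Rightarrow> 'v set" where
  "E_sc_common K f \<tau>p \<tau>m gp gm xp =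
    (THE E. \<exists>xm\<in>M_flat K f \<tau>p \<tau>m gp gm xp. E = E_sc K f \<tau>p \<tau>m gm xp xm)"

end

theory Submission
  imports Defs
begin

text \<open>
  For fixed \<open>y\<^sub>+\<close>, the infimum over \<open>y\<^sub>-\<close> is a Fenchel dual problem: a subgradient at \<open>0\<close> of
  \<open>z \<mapsto> inf\<^sub>\<mu> (g\<^sub>- (\<tau>\<^sub>- \<mu> + z) - f \<mu> - y\<^sub>+ (\<tau>\<^sub>+ \<mu>))\<close> is a minimizer \<open>x\<^sub>-\<close>, and there is no duality
  gap. Since \<open>g\<^sub>-\<close> need not be continuous, it is first replaced by its Lipschitz envelope
  \<open>inf\<^sub>z (g\<^sub>- z + R \<parallel>\<cdot> - z\<parallel>)\<close>, which by the minimal linear growth of \<open>g\<^sub>-\<^sup>*\<close> coincides with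
  \<open>g\<^sub>-\<close> on the ball containing \<open>\<tau>\<^sub>- K\<close> once \<open>R\<close> is large; subgradients then come from Hahn-Banach.
  The equality case of Young's inequality identifies the self-consistent maximizers of
  \<open>\<G>\<close> with the maximizers of \<open>f - g\<^sub>- \<circ> \<tau>\<^sub>- + x\<^sub>+ \<circ> \<tau>\<^sub>+\<close>, whatever \<open>x\<^sub>-\<close> is.
  The dependence on \<open>y\<^sub>+\<close> is a joint supremum over \<open>\<mu>\<close> and \<open>y\<^sub>+\<close>, and a maximizer of the
  nonlinear functional yields an optimal \<open>x\<^sub>+\<close> as a subgradient of \<open>g\<^sub>+\<close>.
\<close>

section \<open>Subgradients of convex functions\<close>

text \<open>Near-minimizers for \<open>x\<close> and for \<open>y\<close> are combined into a
  competitor for the mixed point. Asking only that some index \<open>k\<close> does the job covers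
  both partial minimization of a jointly convex function and infima of chains of convex
  functions.\<close>

lemma convex_on_cINF:
  fixes \<Phi> :: "'i \<Rightarrow> 'a::real_vector \<Rightarrow> real"
  assumes "I \<noteq> {}" and bdd: "\<And>x. bdd_below ((\<lambda>i. \<Phi> i x) ` I)"
    and comb: "\<And>i j x y u v. i \<in> I \<Longrightarrow> j \<in> I \<Longrightarrow> u \<ge> 0 \<Longrightarrow> v \<ge> 0 \<Longrightarrow> u + v = 1 \<Longrightarrow>
      \<exists>k\<in>I. \<Phi> k (u *\<^sub>R x + v *\<^sub>R y) \<le> u * \<Phi> i x + v * \<Phi> j y"
  shows "convex_on UNIV (\<lambda>x. INF i\<in>I. \<Phi> i x)"
  unfolding convex_on_def
proof (intro conjI ballI allI impI)
  fix x y :: 'a and u v :: real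
  assume uv: "u \<ge> 0" "v \<ge> 0" "u + v = 1"
  let ?m = "\<lambda>x. INF i\<in>I. \<Phi> i x"
  show "?m (u *\<^sub>R x + v *\<^sub>R y) \<le> u * ?m x + v * ?m y"
  proof (rule field_le_epsilon)
    fix e :: real assume "e > 0"
    then obtain i j where i: "i \<in> I" "\<Phi> i x < ?m x + e" and j: "j \<in> I" "\<Phi> j y < ?m y + e"
      using cINF_less_iff[OF \<open>I \<noteq> {}\<close> bdd] by (metis less_add_same_cancel1)
    from comb[OF i(1) j(1) uv] obtain k where
      k: "k \<in> I" "\<Phi> k (u *\<^sub>R x + v *\<^sub>R y) \<le> u * \<Phi> i x + v * \<Phi> j y" by blast
    have "?m (u *\<^sub>R x + v *\<^sub>R y) \<le> \<Phi> k (u *\<^sub>R x + v *\<^sub>R y)"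
      by (rule cINF_lower[OF bdd k(1)])
    also note k(2)
    also have "u * \<Phi> i x + v * \<Phi> j y \<le> u * (?m x + e) + v * (?m y + e)"
      using i j uv by (intro add_mono mult_left_mono) auto
    also have "\<dots> = u * ?m x + v * ?m y + e"
      using arg_cong[OF uv(3), of "\<lambda>w. w * e"] by (simp add: algebra_simps)
    finally show "?m (u *\<^sub>R x + v *\<^sub>R y) \<le> u * ?m x + v * ?m y + e" .
  qed
qed simp

lemma convex_on_UNIV_D:
  "convex_on UNIV g \<Longrightarrow> u \<ge> 0 \<Longrightarrow> v \<ge> 0 \<Longrightarrow> u + v = 1 \<Longrightarrow>
    g (u *\<^sub>R x + v *\<^sub>R y) \<le> u * g x + v * g y"
  by (auto simp: convex_on_def)

section \<open>Linear minorants as minimal convex functions (Hahn-Banach)\<close>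

lemma convex_on_ge_uminus:
  assumes "convex_on UNIV p" "p 0 = 0"
  shows "- p (- x) \<le> p x"
proof -
  have "p ((1/2) *\<^sub>R x + (1/2) *\<^sub>R (- x)) \<le> (1/2) * p x + (1/2) * p (- x)"
    by (rule convex_on_UNIV_D[OF assms(1)]) auto
  then show ?thesis using assms(2) by simp
qed

text \<open>Zorn's lemma on the convex functions below \<open>p\<close> that vanish at
  \<open>0\<close>. Pointwise infima of chains stay finite because every such \<open>m\<close>
  satisfies \<open>m x \<ge> - m (- x) \<ge> - p (- x)\<close>.\<close>

lemma minimal_convex_exists:
  fixes p :: "'a::real_vector \<Rightarrow> real"
  assumes p: "convex_on UNIV p" "p 0 = 0"
  obtains m where "convex_on UNIV m" "m 0 = 0" "m \<le> p"
    "\<And>q. convex_on UNIV q \<Longrightarrow> q 0 = 0 \<Longrightarrow> q \<le> m \<Longrightarrow> q = m"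
proof -
  define A where "A = {m. convex_on UNIV m \<and> m 0 = 0 \<and> m \<le> p}"
  have "\<exists>m\<in>A. \<forall>q\<in>A. q \<le> m \<longrightarrow> q = m"
  proof (rule predicate_Zorn)
    \<comment> \<open>\<open>predicate_Zorn\<close> yields maximal elements, so the order is
      reversed to obtain a minimal one.\<close>
    show "partial_order_on A (relation_of (\<lambda>a b. b \<le> a) A)"
      by (rule partial_order_on_relation_ofI) auto
  next
    fix C assume C: "C \<in> Chains (relation_of (\<lambda>a b. b \<le> a) A)"
    then have CA: "C \<subseteq> A" and tot: "\<And>a b. a \<in> C \<Longrightarrow> b \<in> C \<Longrightarrow> a \<le> b \<or> b \<le> a"
      unfolding Chains_def relation_of_def by auto
    show "\<exists>u\<in>A. \<forall>a\<in>C. u \<le> a"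
    proof (cases "C = {}")
      case True
      then show ?thesis using p by (auto simp: A_def)
    next
      case False
      define u where "u = (\<lambda>x. INF m\<in>C. m x)"
      have bdd: "bdd_below ((\<lambda>m. m x) ` C)" for x
      proof (rule bdd_belowI2)
        fix m assume "m \<in> C"
        then have "convex_on UNIV m" "m 0 = 0" "m (- x) \<le> p (- x)"
          using CA by (auto simp: A_def le_fun_def)
        then show "- p (- x) \<le> m x" using convex_on_ge_uminus[of m x] by linarith
      qed
      have le: "u \<le> m" if "m \<in> C" for m
        unfolding u_def le_fun_def using cINF_lower[OF bdd that] by blast
      have "convex_on UNIV u"
        unfolding u_def
      proof (rule convex_on_cINF[OF False bdd])
        fix i j x y and s t :: real
        assume ij: "i \<in> C" "j \<in> C" and st: "s \<ge> 0" "t \<ge> 0" "s + t = 1"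
        \<comment> \<open>In a chain the smaller of \<open>i\<close> and \<open>j\<close> lies below
          both and serves as the combined competitor.\<close>
        from tot[OF ij] obtain k where k: "k \<in> C" "k \<le> i" "k \<le> j" using ij by auto
        have "convex_on UNIV k" using k(1) CA by (auto simp: A_def)
        then have "k (s *\<^sub>R x + t *\<^sub>R y) \<le> s * k x + t * k y"
          using st unfolding convex_on_def by auto
        also have "\<dots> \<le> s * i x + t * j y"
          using k st by (intro add_mono mult_left_mono) (auto simp: le_fun_def)
        finally show "\<exists>k\<in>C. k (s *\<^sub>R x + t *\<^sub>R y) \<le> s * i x + t * j y" using k(1) by blast
      qed
      moreover have "u 0 = 0"
      proof -
        have "(\<lambda>m. m 0) ` C = {0}" using False CA unfolding A_def by (auto simp: subset_iff image_iff Bex_def)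
        then show ?thesis by (simp add: u_def)
      qed
      moreover have "u \<le> p"
      proof -
        from False obtain m where "m \<in> C" by blast
        then show ?thesis using le[of m] CA by (auto simp: A_def)
      qed
      ultimately show ?thesis using le by (auto simp: A_def)
    qed
  qed
  then obtain m where "m \<in> A" "\<And>q. q \<in> A \<Longrightarrow> q \<le> m \<Longrightarrow> q = m" by blast
  then show ?thesis using that[of m] by (auto simp: A_def)
qed

lemma convex_on_scale:
  assumes "convex_on UNIV m" "c \<ge> 0"
  shows "convex_on UNIV (\<lambda>x. c * m (t *\<^sub>R x))"
proof -
  have "m (t *\<^sub>R (u *\<^sub>R x + v *\<^sub>R y)) \<le> u * m (t *\<^sub>R x) + v * m (t *\<^sub>R y)"
    if "u \<ge> 0" "v \<ge> 0" "u + v = 1" for u v x y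
    using convex_on_UNIV_D[OF assms(1) that, of "t *\<^sub>R x" "t *\<^sub>R y"]
    by (simp add: scaleR_add_right mult.commute)
  then have "c * m (t *\<^sub>R (u *\<^sub>R x + v *\<^sub>R y)) \<le> u * (c * m (t *\<^sub>R x)) + v * (c * m (t *\<^sub>R y))"
    if "u \<ge> 0" "v \<ge> 0" "u + v = 1" for u v x y
    using mult_left_mono[OF _ assms(2)] that by (metis (no_types) distrib_left mult.left_commute)
  then show ?thesis unfolding convex_on_def by auto
qed

text \<open>Homogeneity and oddness each come from a convex function below \<open>m\<close> that
  vanishes at \<open>0\<close>: minimality forces it to equal \<open>m\<close>. Subadditivity then
  follows from convexity and homogeneity.\<close>

lemma minimal_convex_imp_linear:
  fixes m :: "'a::real_vector \<Rightarrow> real"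
  assumes cvx: "convex_on UNIV m" and m0: "m 0 = 0"
    and min: "\<And>q. convex_on UNIV q \<Longrightarrow> q 0 = 0 \<Longrightarrow> q \<le> m \<Longrightarrow> q = m"
  shows "linear m"
proof -
  have hom1: "m (t *\<^sub>R x) = t * m x" if "0 < t" "t \<le> 1" for t x
  proof -
    have "(\<lambda>x. (1 / t) * m (t *\<^sub>R x)) = m"
    proof (rule min)
      show "convex_on UNIV (\<lambda>x. (1 / t) * m (t *\<^sub>R x))"
        using cvx that by (intro convex_on_scale) auto
      have "m (t *\<^sub>R x + (1 - t) *\<^sub>R 0) \<le> t * m x + (1 - t) * m 0" for x
        using that by (intro convex_on_UNIV_D[OF cvx]) auto
      then show "(\<lambda>x. (1 / t) * m (t *\<^sub>R x)) \<le> m"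
        using that m0 by (auto simp: le_fun_def field_simps)
    qed (use m0 in auto)
    then have "(1 / t) * m (t *\<^sub>R x) = m x" by (rule fun_cong)
    then show ?thesis using that by (simp add: field_simps)
  qed
  have hom: "m (t *\<^sub>R x) = t * m x" if "0 \<le> t" for t x
  proof (cases "t \<le> 1")
    case True
    then show ?thesis using hom1[of t x] that m0 by (cases "t = 0") auto
  next
    case False
    \<comment> \<open>For \<open>t > 1\<close>, the factor \<open>1 / t\<close> is covered by
      \<open>hom1\<close>, applied at the point \<open>t *\<^sub>R x\<close>.\<close>
    then have "m ((1 / t) *\<^sub>R (t *\<^sub>R x)) = (1 / t) * m (t *\<^sub>R x)"
      by (intro hom1) auto
    then show ?thesis using False by simp
  qed
  have sub: "m (x + y) \<le> m x + m y" for x y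
  proof -
    have "m ((1/2) *\<^sub>R (2 *\<^sub>R x) + (1/2) *\<^sub>R (2 *\<^sub>R y)) \<le> (1/2) * m (2 *\<^sub>R x) + (1/2) * m (2 *\<^sub>R y)"
      by (rule convex_on_UNIV_D[OF cvx]) auto
    then show ?thesis using hom[of 2] by simp
  qed
  have odd: "m (- a) = - m a" for a
  proof (rule antisym)
    \<comment> \<open>The infimum over \<open>t\<close> again lies below \<open>m\<close>, as
      \<open>t = 0\<close> shows, so it equals \<open>m\<close>; the choice \<open>t = 1\<close> at
      \<open>- a\<close> then gives \<open>m (- a) \<le> - m a\<close>.\<close>
    define \<Phi> where "\<Phi> t x = m (x + t *\<^sub>R a) - t * m a" for t x
    have bdd: "bdd_below ((\<lambda>t. \<Phi> t x) ` {0..})" for x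
    proof (rule bdd_belowI2)
      fix t :: real assume "t \<in> {0..}"
      then have "t * m a = m (t *\<^sub>R a)" using hom by auto
      also have "\<dots> \<le> m (x + t *\<^sub>R a) + m (- x)" using sub[of "x + t *\<^sub>R a" "- x"] by simp
      finally show "- m (- x) \<le> \<Phi> t x" by (simp add: \<Phi>_def)
    qed
    have "(\<lambda>x. INF t\<in>{0..}. \<Phi> t x) = m"
    proof (rule min)
      show "convex_on UNIV (\<lambda>x. INF t\<in>{0..}. \<Phi> t x)"
      proof (rule convex_on_cINF[OF _ bdd])
        fix i j u v :: real and x y :: 'a
        assume *: "i \<in> {0..}" "j \<in> {0..}" "u \<ge> 0" "v \<ge> 0" "u + v = 1"
        have eq: "u *\<^sub>R x + v *\<^sub>R y + (u * i + v * j) *\<^sub>R a = u *\<^sub>R (x + i *\<^sub>R a) + v *\<^sub>R (y + j *\<^sub>R a)"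
          by (simp add: algebra_simps)
        have "\<Phi> (u * i + v * j) (u *\<^sub>R x + v *\<^sub>R y) \<le> u * \<Phi> i x + v * \<Phi> j y"
          using convex_on_UNIV_D[OF cvx *(3-5), of "x + i *\<^sub>R a" "y + j *\<^sub>R a"]
          unfolding \<Phi>_def eq by (simp add: algebra_simps)
        then show "\<exists>k\<in>{0..}. \<Phi> k (u *\<^sub>R x + v *\<^sub>R y) \<le> u * \<Phi> i x + v * \<Phi> j y"
          using * by (intro bexI[of _ "u * i + v * j"]) auto
      qed simp
      \<comment> \<open>By homogeneity \<open>m (t *\<^sub>R a) = t * m a\<close>, so every
        competitor at \<open>0\<close> vanishes.\<close>
      have "(\<lambda>t. \<Phi> t 0) ` {0..} = {0}" using hom by (auto simp: \<Phi>_def image_def intro: exI[of _ 0])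
      then show "(INF t\<in>{0..}. \<Phi> t 0) = 0" by simp
      show "(\<lambda>x. INF t\<in>{0..}. \<Phi> t x) \<le> m"
        using cINF_lower[OF bdd, of 0] by (auto simp: le_fun_def \<Phi>_def)
    qed
    then have "m (- a) = (INF t\<in>{0..}. \<Phi> t (- a))" by metis
    also have "\<dots> \<le> \<Phi> 1 (- a)" by (rule cINF_lower[OF bdd]) auto
    finally show "m (- a) \<le> - m a" by (simp add: \<Phi>_def m0)
    show "- m a \<le> m (- a)" using convex_on_ge_uminus[OF cvx m0, of "- a"] by simp
  qed
  show ?thesis
  proof (rule linearI)
    fix x y
    have "m (- x + - y) \<le> m (- x) + m (- y)" by (rule sub)
    then show "m (x + y) = m x + m y" using sub[of x y] odd[of "x + y"] odd[of x] odd[of y] by simp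
  next
    fix t :: real and x
    show "m (t *\<^sub>R x) = t *\<^sub>R m x"
      using hom[of t x] hom[of "- t" x] odd[of "t *\<^sub>R x"] by (cases "0 \<le> t") auto
  qed
qed

text \<open>The increment of \<open>g\<close> at \<open>x\<close> is convex and vanishes at
  \<open>0\<close>, so a minimal convex function below it is linear. The upper bound on a ball,
  together with oddness, makes this linear functional bounded.\<close>

lemma subdifferential_nonempty:
  fixes g :: "'a::real_normed_vector \<Rightarrow> real"
  assumes cvx: "convex_on UNIV g" and "r > 0" and bd: "\<And>z. norm z \<le> r \<Longrightarrow> g (x + z) \<le> C"
  shows "subdifferential g x \<noteq> {}"
proof -
  define p where "p z = g (x + z) - g x" for z
  have "p (u *\<^sub>R y + v *\<^sub>R z) \<le> u * p y + v * p z" if "u \<ge> 0" "v \<ge> 0" "u + v = 1" for u v y z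
  proof -
    have "x = u *\<^sub>R x + v *\<^sub>R x" "g x = u * g x + v * g x" using that by (simp_all flip: scaleR_left_distrib distrib_right)
    then have eq: "x + (u *\<^sub>R y + v *\<^sub>R z) = u *\<^sub>R (x + y) + v *\<^sub>R (x + z)"
      by (simp add: scaleR_right_distrib algebra_simps)
    have "g (u *\<^sub>R (x + y) + v *\<^sub>R (x + z)) \<le> u * g (x + y) + v * g (x + z)"
      using cvx that unfolding convex_on_def by auto
    then show ?thesis unfolding p_def eq using \<open>g x = _\<close> by (simp add: algebra_simps)
  qed
  then have "convex_on UNIV p" unfolding convex_on_def by auto
  moreover have "p 0 = 0" by (simp add: p_def)
  ultimately obtain m where m: "linear m" "m \<le> p"
    using minimal_convex_exists minimal_convex_imp_linear by metis
  have le: "m z \<le> (C - g x) / r * norm z" for z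
  proof (cases "z = 0")
    case True
    then show ?thesis using m(1) linear_0 by fastforce
  next
    case False
    \<comment> \<open>Rescaling \<open>z\<close> to norm \<open>r\<close> brings it into the ball
      where \<open>g\<close> is bounded by \<open>C\<close>.\<close>
    then have "m ((r / norm z) *\<^sub>R z) \<le> C - g x"
      using m(2) bd[of "(r / norm z) *\<^sub>R z"] \<open>r > 0\<close> by (auto simp: le_fun_def p_def intro: order_trans)
    then have "r / norm z * m z \<le> C - g x" using linear_scale[OF m(1)] by simp
    then show ?thesis using False \<open>r > 0\<close> by (simp add: field_simps)
  qed
  have "\<bar>m z\<bar> \<le> norm z * ((C - g x) / r)" for z
  proof (rule abs_leI)
    show "m z \<le> norm z * ((C - g x) / r)" using le[of z] by (subst mult.commute)
    show "- m z \<le> norm z * ((C - g x) / r)"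
      using le[of "- z"] unfolding linear_neg[OF m(1)] norm_minus_cancel by (subst mult.commute)
  qed
  then have "bounded_linear m"
    using m(1) by (intro bounded_linear_intro[where K = "(C - g x) / r"]) (auto simp: linear_add linear_scale)
  then have "blinfun_apply (Blinfun m) = m" by (rule bounded_linear_Blinfun_apply)
  moreover have "m (y - x) \<le> g y - g x" for y
    using m(2) by (auto simp: le_fun_def p_def dest: spec[of _ "y - x"])
  ultimately have "Blinfun m \<in> subdifferential g x" by (simp add: subdifferential_def)
  then show ?thesis by blast
qed

section \<open>Lipschitz envelopes and Fenchel duality\<close>

text \<open>A real-valued form of an upper bound on the conjugate, which keeps the convex analysis
  free of extended reals.\<close>

definition affine_minorant :: "('a::real_normed_vector \<Rightarrow> real) \<Rightarrow> 'a dual \<Rightarrow> real \<Rightarrow> bool" where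
  "affine_minorant g y c \<longleftrightarrow> (\<forall>z. blinfun_apply y z - c \<le> g z)"

lemma legendre_fenchel_le_iff: "legendre_fenchel g y \<le> ereal c \<longleftrightarrow> affine_minorant g y c"
  by (auto simp: legendre_fenchel_def affine_minorant_def SUP_le_iff algebra_simps)

lemma blinfun_apply_le: "blinfun_apply y x \<le> norm y * norm x"
  for y :: "'a::real_normed_vector dual"
  using norm_blinfun[of y x] by simp

text \<open>The infimal convolution of \<open>g\<close> with \<open>R * norm\<close>, that is, the
  largest \<open>R\<close>-Lipschitz function below \<open>g\<close>. The real infimum is meaningful
  only if bounded below, which an affine minorant with slope of norm at most \<open>R\<close>
  ensures.\<close>

definition lipschitz_envelope :: "('a::real_normed_vector \<Rightarrow> real) \<Rightarrow> real \<Rightarrow> 'a \<Rightarrow> real" where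
  "lipschitz_envelope g R x = (INF z. g z + R * norm (x - z))"

lemma affine_minorant_le:
  assumes "affine_minorant g y c" "norm y \<le> R"
  shows "blinfun_apply y x - c \<le> g z + R * norm (x - z)"
proof -
  have "blinfun_apply y (x - z) \<le> norm y * norm (x - z)" by (rule blinfun_apply_le)
  also have "\<dots> \<le> R * norm (x - z)" using assms(2) by (intro mult_right_mono) auto
  finally have "blinfun_apply y x - blinfun_apply y z \<le> R * norm (x - z)"
    by (simp only: blinfun.diff_right)
  moreover have "blinfun_apply y z - c \<le> g z" using assms(1) by (simp add: affine_minorant_def)
  ultimately show ?thesis by linarith
qed

lemma affine_minorant_le_lipschitz_envelope:
  assumes "affine_minorant g y c" "norm y \<le> R"
  shows "blinfun_apply y x - c \<le> lipschitz_envelope g R x"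
  unfolding lipschitz_envelope_def using affine_minorant_le[OF assms] by (intro cINF_greatest) auto

section \<open>The envelope when some affine minorant keeps it finite\<close>

context
  fixes g :: "'a::real_normed_vector \<Rightarrow> real" and y c R
  assumes minorant: "affine_minorant g y c" "norm y \<le> R"
begin

lemma bdd_below_lipschitz_envelope: "bdd_below (range (\<lambda>z. g z + R * norm (x - z)))"
  using affine_minorant_le[OF minorant] by (intro bdd_belowI2)

lemma lipschitz_envelope_lower: "lipschitz_envelope g R x \<le> g z + R * norm (x - z)"
  unfolding lipschitz_envelope_def by (intro cINF_lower bdd_below_lipschitz_envelope) auto

lemma lipschitz_envelope_le: "lipschitz_envelope g R x \<le> g x"
  using lipschitz_envelope_lower[of x x] by simp

lemma lipschitz_envelope_lipschitz:
  "lipschitz_envelope g R x \<le> lipschitz_envelope g R x' + R * norm (x - x')"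
proof -
  have "0 \<le> R" using minorant(2) norm_ge_zero order_trans by blast
  have "lipschitz_envelope g R x - R * norm (x - x') \<le> g z + R * norm (x' - z)" for z
  proof -
    have "R * norm (x - z) \<le> R * (norm (x - x') + norm (x' - z))"
      using \<open>0 \<le> R\<close> norm_triangle_ineq[of "x - x'" "x' - z"] by (intro mult_left_mono) auto
    then show ?thesis using lipschitz_envelope_lower[of x z] by (simp add: distrib_left)
  qed
  then have "lipschitz_envelope g R x - R * norm (x - x') \<le> lipschitz_envelope g R x'"
    unfolding lipschitz_envelope_def[of g R x'] by (intro cINF_greatest) auto
  then show ?thesis by simp
qed

text \<open>Partial minimization over \<open>z\<close> of a function jointly convex in
  \<open>x\<close> and \<open>z\<close>.\<close>

lemma convex_on_lipschitz_envelope: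
  assumes "convex_on UNIV g"
  shows "convex_on UNIV (lipschitz_envelope g R)"
proof -
  have "0 \<le> R" using minorant(2) norm_ge_zero order_trans by blast
  have "convex_on UNIV (\<lambda>x. INF z. g z + R * norm (x - z))"
  proof (rule convex_on_cINF[OF _ bdd_below_lipschitz_envelope])
    fix i j x z :: 'a and u v :: real
    assume uv: "u \<ge> 0" "v \<ge> 0" "u + v = 1"
    have "norm (u *\<^sub>R x + v *\<^sub>R z - (u *\<^sub>R i + v *\<^sub>R j)) = norm (u *\<^sub>R (x - i) + v *\<^sub>R (z - j))"
      by (simp add: algebra_simps)
    also have "\<dots> \<le> u * norm (x - i) + v * norm (z - j)"
      using norm_triangle_ineq[of "u *\<^sub>R (x - i)" "v *\<^sub>R (z - j)"] uv by simp
    finally have "R * norm (u *\<^sub>R x + v *\<^sub>R z - (u *\<^sub>R i + v *\<^sub>R j))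
        \<le> R * (u * norm (x - i) + v * norm (z - j))"
      using \<open>0 \<le> R\<close> by (intro mult_left_mono)
    then show "\<exists>k\<in>UNIV. g k + R * norm (u *\<^sub>R x + v *\<^sub>R z - k)
        \<le> u * (g i + R * norm (x - i)) + v * (g j + R * norm (z - j))"
      using convex_on_UNIV_D[OF assms uv, of i j]
      by (intro bexI[of _ "u *\<^sub>R i + v *\<^sub>R j"]) (auto simp: algebra_simps)
  qed simp
  then show ?thesis by (simp add: lipschitz_envelope_def[abs_def])
qed

text \<open>The envelope is convex and Lipschitz, so it has subgradients everywhere, even where
  \<open>g\<close> may have none. Since the envelope lies below \<open>g\<close>, its supporting
  affine function at \<open>x\<close> is also a minorant of \<open>g\<close>.\<close>

lemma lipschitz_envelope_subgradient:
  assumes "convex_on UNIV g"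
  obtains y' where "affine_minorant g y' (blinfun_apply y' x - lipschitz_envelope g R x)"
proof -
  have "0 \<le> R" using minorant(2) norm_ge_zero order_trans by blast
  have "subdifferential (lipschitz_envelope g R) x \<noteq> {}"
  proof (rule subdifferential_nonempty[OF convex_on_lipschitz_envelope[OF assms] zero_less_one])
    fix z :: 'a assume "norm z \<le> 1"
    then have "R * norm z \<le> R * 1" using \<open>0 \<le> R\<close> by (rule mult_left_mono)
    then show "lipschitz_envelope g R (x + z) \<le> lipschitz_envelope g R x + R"
      using lipschitz_envelope_lipschitz[of "x + z" x] by simp
  qed
  then obtain y' where y': "\<And>z. blinfun_apply y' (z - x) \<le> lipschitz_envelope g R z - lipschitz_envelope g R x"
    by (auto simp: subdifferential_def)
  have "blinfun_apply y' z - (blinfun_apply y' x - lipschitz_envelope g R x) \<le> g z" for z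
    using y'[of z] lipschitz_envelope_le[of z] unfolding blinfun.diff_right by linarith
  then show ?thesis by (intro that[of y']) (simp add: affine_minorant_def)
qed

end

text \<open>Close to \<open>x\<close>, semicontinuity keeps \<open>g\<close> large; at distance at
  least \<open>d\<close>, the penalty in excess of \<open>norm y\<close> makes up for the deficit of
  the affine minorant.\<close>

lemma lipschitz_envelope_approx:
  fixes g :: "'a::real_normed_vector \<Rightarrow> real"
  assumes lsc: "lower_semicontinuous_on UNIV g" and minorant: "affine_minorant g y c"
    and "a < g x"
  obtains R where "norm y \<le> R" "a < lipschitz_envelope g R x"
proof -
  \<comment> \<open>The bound on an infimum is only non-strict, so an intermediate value is needed
    to end with a strict inequality.\<close>
  obtain b where b: "a < b" "b < g x" using dense[OF \<open>a < g x\<close>] by blast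
  have "\<forall>\<^sub>F z in at x. b < g z"
    using lsc b(2) unfolding lower_semicontinuous_on_def by auto
  then obtain d where d: "d > 0" "\<And>z. z \<noteq> x \<Longrightarrow> dist z x < d \<Longrightarrow> b < g z"
    unfolding eventually_at by auto
  \<comment> \<open>Chosen so that \<open>(R - norm y) * d\<close> equals the absolute value of the
    gap between \<open>b\<close> and the affine minorant at \<open>x\<close>.\<close>
  define R where "R = norm y + \<bar>b - blinfun_apply y x + c\<bar> / d"
  have R: "norm y \<le> R" using \<open>d > 0\<close> by (simp add: R_def)
  have "b \<le> g z + R * norm (x - z)" for z
  proof (cases "dist z x < d")
    case True
    then have "b < g z" using d b by (cases "z = x") auto
    moreover have "0 \<le> R * norm (x - z)" using R order_trans[OF norm_ge_zero R] by simp
    ultimately show ?thesis by linarith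
  next
    case False
    have "b - blinfun_apply y x + c \<le> \<bar>b - blinfun_apply y x + c\<bar> / d * d"
      using \<open>d > 0\<close> by simp
    also have "\<dots> \<le> \<bar>b - blinfun_apply y x + c\<bar> / d * norm (x - z)"
      using False \<open>d > 0\<close> by (intro mult_left_mono) (auto simp: dist_norm norm_minus_commute)
    finally have "b - blinfun_apply y x + c \<le> R * norm (x - z) - norm y * norm (x - z)"
      by (simp add: R_def algebra_simps)
    moreover have "blinfun_apply y x - c \<le> g z + norm y * norm (x - z)"
      by (rule affine_minorant_le[OF minorant]) simp
    ultimately show ?thesis by linarith
  qed
  then have "b \<le> lipschitz_envelope g R x"
    unfolding lipschitz_envelope_def by (intro cINF_greatest) auto
  then show ?thesis using that[OF R] b by linarith
qed

text \<open>An affine minorant with a slope larger than \<open>R\<close> cannot beat the given one on the ball of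
  radius \<open>l\<close>, so that slopes bounded by \<open>R\<close> suffice there.\<close>

lemma lipschitz_envelope_eq:
  fixes g :: "'a::real_normed_vector \<Rightarrow> real"
  assumes cvx: "convex_on UNIV g" and lsc: "lower_semicontinuous_on UNIV g"
    and minorant: "affine_minorant g y0 c0"
    and growth: "\<And>N. \<exists>R. \<forall>y c. R < norm y \<longrightarrow> affine_minorant g y c \<longrightarrow> l * norm y - c \<le> N"
  obtains R where "norm y0 \<le> R" "\<And>x. norm x \<le> l \<Longrightarrow> lipschitz_envelope g R x = g x"
proof -
  \<comment> \<open>The threshold is a lower bound for the given affine minorant on the ball of
    radius \<open>l\<close>, hence also for the envelope there.\<close>
  obtain R' where R': "\<And>y c. R' < norm y \<Longrightarrow> affine_minorant g y c \<Longrightarrow>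
      l * norm y - c \<le> - (l * norm y0) - c0"
    using growth by blast
  define R where "R = max R' (norm y0)"
  have R: "norm y0 \<le> R" by (simp add: R_def)
  have "lipschitz_envelope g R x = g x" if x: "norm x \<le> l" for x
  proof (rule ccontr)
    assume "lipschitz_envelope g R x \<noteq> g x"
    then have "lipschitz_envelope g R x < g x"
      using lipschitz_envelope_le[OF minorant R, of x] by simp
    then obtain n where n: "norm y0 \<le> n" "lipschitz_envelope g R x < lipschitz_envelope g n x"
      by (rule lipschitz_envelope_approx[OF lsc minorant])
    \<comment> \<open>The minorant supporting the better envelope at \<open>x\<close> exceeds the
      \<open>R\<close>-envelope there. A slope of norm at most \<open>R\<close> contradicts the
      definition of that envelope, a larger slope contradicts the growth bound.\<close>
    obtain y where y: "affine_minorant g y (blinfun_apply y x - lipschitz_envelope g n x)"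
      by (rule lipschitz_envelope_subgradient[OF minorant n(1) cvx])
    have *: "norm z * norm x \<le> l * norm z" for z :: "'a dual"
      using x by (simp add: mult.commute mult_right_mono)
    show False
    proof (cases "norm y \<le> R")
      case True
      then show False using affine_minorant_le_lipschitz_envelope[OF y True, of x] n by simp
    next
      case False
      then have "l * norm y - (blinfun_apply y x - lipschitz_envelope g n x) \<le> - (l * norm y0) - c0"
        using y by (intro R') (auto simp: R_def)
      moreover have "blinfun_apply y x \<le> l * norm y"
        using blinfun_apply_le[of y x] *[of y] by linarith
      moreover have "- (l * norm y0) \<le> blinfun_apply y0 x"
        using blinfun_apply_le[of y0 "- x"] *[of y0] by (simp add: blinfun.minus_right)
      ultimately show False
        using affine_minorant_le_lipschitz_envelope[OF minorant R, of x] n by linarith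
    qed
  qed
  with R show ?thesis by (rule that)
qed

text \<open>The dual solution \<open>y\<close> is a subgradient at \<open>0\<close> of the value
  function \<open>p\<close> of the problem perturbed by \<open>z\<close>. The Lipschitz bound makes
  \<open>p\<close> finite and bounded above near \<open>0\<close>. As \<open>\<mu>\<close> and
  \<open>x\<close> vary independently, the conclusion bounds the dual objective without forming a
  conjugate.\<close>

lemma fenchel_duality_lipschitz:
  fixes D :: "'v::real_vector set" and \<tau> :: "'v \<Rightarrow> 'a::real_normed_vector"
  assumes "D \<noteq> {}" and h: "concave_on D h" and \<tau>: "affine_map_on D \<tau>"
    and e: "convex_on UNIV e" and lip: "\<And>x z. e x \<le> e z + L * norm (x - z)"
    and s: "\<And>\<mu>. \<mu> \<in> D \<Longrightarrow> h \<mu> - e (\<tau> \<mu>) \<le> s"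
  shows "\<exists>y :: 'a dual. \<forall>\<mu>\<in>D. \<forall>x.
    h \<mu> - blinfun_apply y (\<tau> \<mu>) + blinfun_apply y x - e x \<le> s"
proof -
  define \<Phi> where "\<Phi> \<mu> z = e (\<tau> \<mu> + z) - h \<mu>" for \<mu> z
  define p where "p z = (INF \<mu>\<in>D. \<Phi> \<mu> z)" for z
  have lower: "- s - L * norm z \<le> \<Phi> \<mu> z" if "\<mu> \<in> D" for \<mu> z
    using lip[of "\<tau> \<mu>" "\<tau> \<mu> + z"] s[OF that] by (simp add: \<Phi>_def)
  then have bdd: "bdd_below ((\<lambda>\<mu>. \<Phi> \<mu> z) ` D)" for z by (rule bdd_belowI2)
  have "convex_on UNIV p"
    unfolding p_def
  proof (rule convex_on_cINF[OF \<open>D \<noteq> {}\<close> bdd])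
    fix \<mu> \<nu> x z and u v :: real
    assume *: "\<mu> \<in> D" "\<nu> \<in> D" "u \<ge> 0" "v \<ge> 0" "u + v = 1"
    have "\<tau> (u *\<^sub>R \<mu> + v *\<^sub>R \<nu>) = u *\<^sub>R \<tau> \<mu> + v *\<^sub>R \<tau> \<nu>"
    proof -
      have "u = 1 - v" "v \<in> {0..1}" using * by auto
      then show ?thesis using \<tau> * unfolding affine_map_on_def by blast
    qed
    then have "\<tau> (u *\<^sub>R \<mu> + v *\<^sub>R \<nu>) + (u *\<^sub>R x + v *\<^sub>R z) = u *\<^sub>R (\<tau> \<mu> + x) + v *\<^sub>R (\<tau> \<nu> + z)"
      by (simp add: algebra_simps)
    moreover have "u * h \<mu> + v * h \<nu> \<le> h (u *\<^sub>R \<mu> + v *\<^sub>R \<nu>)" "u *\<^sub>R \<mu> + v *\<^sub>R \<nu> \<in> D"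
      using h * unfolding concave_on_iff by (auto simp: convex_def)
    ultimately show "\<exists>k\<in>D. \<Phi> k (u *\<^sub>R x + v *\<^sub>R z) \<le> u * \<Phi> \<mu> x + v * \<Phi> \<nu> z"
      using convex_on_UNIV_D[OF e *(3-5), of "\<tau> \<mu> + x" "\<tau> \<nu> + z"]
      by (intro bexI[of _ "u *\<^sub>R \<mu> + v *\<^sub>R \<nu>"]) (auto simp: \<Phi>_def algebra_simps)
  qed
  moreover have le: "p z \<le> \<Phi> \<mu> z" if "\<mu> \<in> D" for \<mu> z
    unfolding p_def by (rule cINF_lower[OF bdd that])
  obtain \<mu>0 where \<mu>0: "\<mu>0 \<in> D" using \<open>D \<noteq> {}\<close> by blast
  ultimately have "subdifferential p 0 \<noteq> {}"
  proof (intro subdifferential_nonempty[where r = 1])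
    fix z :: 'a assume "norm z \<le> 1"
    have "L * norm z \<le> \<bar>L\<bar> * 1" using \<open>norm z \<le> 1\<close> by (intro mult_mono) auto
    then show "p (0 + z) \<le> e (\<tau> \<mu>0) + \<bar>L\<bar> - h \<mu>0"
      using le[OF \<mu>0, of z] lip[of "\<tau> \<mu>0 + z" "\<tau> \<mu>0"] by (simp add: \<Phi>_def)
  qed auto
  then obtain y where y: "\<And>z. blinfun_apply y z \<le> p z - p 0" by (auto simp: subdifferential_def)
  have "- s \<le> p 0"
    unfolding p_def using lower[of _ 0] \<open>D \<noteq> {}\<close> by (intro cINF_greatest) auto
  \<comment> \<open>The perturbation \<open>z = x - \<tau> \<mu>\<close> moves
    \<open>\<tau> \<mu>\<close> to the arbitrary point \<open>x\<close>.\<close>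
  have "h \<mu> - blinfun_apply y (\<tau> \<mu>) + blinfun_apply y x - e x \<le> s" if "\<mu> \<in> D" for \<mu> x
    using y[of "x - \<tau> \<mu>"] le[OF that, of "x - \<tau> \<mu>"] \<open>- s \<le> p 0\<close>
    by (simp add: \<Phi>_def blinfun.diff_right)
  then show ?thesis by blast
qed

lemma fenchel_duality:
  fixes D :: "'v::real_vector set" and \<tau> :: "'v \<Rightarrow> 'a::real_normed_vector"
  assumes "D \<noteq> {}" and "concave_on D h" and "affine_map_on D \<tau>"
    and bound: "\<And>\<mu>. \<mu> \<in> D \<Longrightarrow> norm (\<tau> \<mu>) \<le> l"
    and cvx: "convex_on UNIV g" and lsc: "lower_semicontinuous_on UNIV g"
    and dom: "effective_domain (legendre_fenchel g) \<noteq> {}"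
    and growth: "minimal_linear_growth (legendre_fenchel g) l"
    and s: "\<And>\<mu>. \<mu> \<in> D \<Longrightarrow> h \<mu> - g (\<tau> \<mu>) \<le> s"
  shows "\<exists>y :: 'a dual. \<forall>\<mu>\<in>D. \<forall>x.
    h \<mu> - blinfun_apply y (\<tau> \<mu>) + blinfun_apply y x - g x \<le> s"
proof -
  obtain y0 where "legendre_fenchel g y0 < \<infinity>" using dom by (auto simp: effective_domain_def)
  then obtain c0 where "legendre_fenchel g y0 \<le> ereal c0"
    using ereal_dense2 less_imp_le by blast
  then have minorant: "affine_minorant g y0 c0" by (simp add: legendre_fenchel_le_iff)
  \<comment> \<open>The extended-real growth limit becomes a statement on affine minorants with
    large slope.\<close>
  have growth': "\<exists>R. \<forall>y c. R < norm y \<longrightarrow> affine_minorant g y c \<longrightarrow> l * norm y - c \<le> N" for N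
  proof -
    have "\<forall>\<^sub>F R in at_top. (SUP y\<in>- cball 0 R. ereal (l * norm y) - legendre_fenchel g y) < ereal N"
      using growth unfolding minimal_linear_growth_def by (rule order_tendstoD) simp
    then obtain R where R: "(SUP y\<in>- cball 0 R. ereal (l * norm y) - legendre_fenchel g y) < ereal N"
      by (auto simp: eventually_at_top_linorder)
    have "l * norm y - c \<le> N" if "R < norm y" "affine_minorant g y c" for y c
    proof -
      have "ereal (l * norm y - c) \<le> ereal (l * norm y) - legendre_fenchel g y"
        using that(2) unfolding legendre_fenchel_le_iff[symmetric]
        by (cases "legendre_fenchel g y") auto
      also have "\<dots> \<le> ereal N"
        using R that(1) by (intro order.trans[OF SUP_upper less_imp_le]) auto
      finally show ?thesis by simp
    qed
    then show ?thesis by blast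
  qed
  obtain R where R: "norm y0 \<le> R" "\<And>x. norm x \<le> l \<Longrightarrow> lipschitz_envelope g R x = g x"
    using lipschitz_envelope_eq[OF cvx lsc minorant growth'] by blast
  have "\<exists>y :: 'a dual. \<forall>\<mu>\<in>D. \<forall>x.
      h \<mu> - blinfun_apply y (\<tau> \<mu>) + blinfun_apply y x - lipschitz_envelope g R x \<le> s"
  proof (rule fenchel_duality_lipschitz[OF assms(1-3)])
    show "convex_on UNIV (lipschitz_envelope g R)"
      by (rule convex_on_lipschitz_envelope[OF minorant R(1) cvx])
    show "lipschitz_envelope g R x \<le> lipschitz_envelope g R z + R * norm (x - z)" for x z
      by (rule lipschitz_envelope_lipschitz[OF minorant R(1)])
    show "h \<mu> - lipschitz_envelope g R (\<tau> \<mu>) \<le> s" if "\<mu> \<in> D" for \<mu>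
      using s[OF that] R(2)[OF bound[OF that]] by simp
  qed
  then obtain y :: "'a dual" where y: "\<And>\<mu> x. \<mu> \<in> D \<Longrightarrow>
      h \<mu> - blinfun_apply y (\<tau> \<mu>) + blinfun_apply y x - lipschitz_envelope g R x \<le> s"
    by blast
  have "h \<mu> - blinfun_apply y (\<tau> \<mu>) + blinfun_apply y x - g x \<le> s" if "\<mu> \<in> D" for \<mu> x
    using y[OF that, of x] lipschitz_envelope_le[OF minorant R(1), of x] by linarith
  then show ?thesis by blast
qed

section \<open>Semicontinuity\<close>

lemma upper_semicontinuous_onE:
  assumes "upper_semicontinuous_on S h" "x \<in> S" "h x < a"
  obtains U where "open U" "x \<in> U" "\<And>y. y \<in> U \<Longrightarrow> y \<in> S \<Longrightarrow> h y < a"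
proof -
  have "\<forall>\<^sub>F y in at x within S. h y < a"
    using assms unfolding upper_semicontinuous_on_def by blast
  then obtain U where "open U" "x \<in> U" "\<forall>y\<in>U. y \<noteq> x \<longrightarrow> y \<in> S \<longrightarrow> h y < a"
    unfolding eventually_at_topological by blast
  then show ?thesis using that[of U] assms(3) by metis
qed

lemma compact_superlevel:
  assumes "compact K" "upper_semicontinuous_on K h"
  shows "compact {x\<in>K. c \<le> h x}"
proof -
  have "openin (top_of_set K) {x\<in>K. h x < c}"
  proof (subst openin_subopen, intro ballI)
    fix x assume x: "x \<in> {x\<in>K. h x < c}"
    then obtain U where "open U" "x \<in> U" "\<And>y. y \<in> U \<Longrightarrow> y \<in> K \<Longrightarrow> h y < c"
      using upper_semicontinuous_onE[OF assms(2)] by (metis (no_types, lifting) mem_Collect_eq)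
    then show "\<exists>T. openin (top_of_set K) T \<and> x \<in> T \<and> T \<subseteq> {x\<in>K. h x < c}"
      using x \<open>open U\<close> \<open>x \<in> U\<close> by (intro exI[of _ "K \<inter> U"]) (auto simp: openin_open_Int)
  qed
  then have "closedin (top_of_set K) (K - {x\<in>K. h x < c})"
    by (intro closedin_diff) auto
  then have "compact (K - {x\<in>K. h x < c})" using assms(1) by (rule closedin_compact[rotated])
  also have "K - {x\<in>K. h x < c} = {x\<in>K. c \<le> h x}" by auto
  finally show ?thesis .
qed

text \<open>If every \<open>x\<close> had a better point \<open>b x\<close>, the open sets on which
  \<open>h < h (b x)\<close> would cover \<open>K\<close>. In a finite subcover, the best of the
  points \<open>b c\<close> lies in one of these sets, a contradiction.\<close>

lemma upper_semicontinuous_on_attains_sup: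
  assumes "compact K" "K \<noteq> {}" "upper_semicontinuous_on K h"
  obtains x where "x \<in> K" "\<And>y. y \<in> K \<Longrightarrow> h y \<le> h x"
proof (rule ccontr)
  assume "\<not> thesis"
  then have "\<forall>x\<in>K. \<exists>y\<in>K. h x < h y" using that by (meson not_le)
  then obtain b where b: "\<And>x. x \<in> K \<Longrightarrow> b x \<in> K \<and> h x < h (b x)" by metis
  have "\<exists>U. open U \<and> x \<in> U \<and> (\<forall>y\<in>U. y \<in> K \<longrightarrow> h y < h (b x))" if "x \<in> K" for x
    using upper_semicontinuous_onE[OF assms(3) that] b[OF that] by metis
  then obtain U where U: "\<And>x. x \<in> K \<Longrightarrow> open (U x) \<and> x \<in> U x \<and> (\<forall>y\<in>U x. y \<in> K \<longrightarrow> h y < h (b x))"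
    by metis
  obtain C where C: "C \<subseteq> K" "finite C" "K \<subseteq> (\<Union>c\<in>C. U c)"
    using compactE_image[OF assms(1), of K U] U by blast
  then have "C \<noteq> {}" using assms(2) by auto
  then have "Max ((\<lambda>c. h (b c)) ` C) \<in> (\<lambda>c. h (b c)) ` C" using C(2) by (intro Max_in) auto
  then obtain c where c: "c \<in> C" "h (b c) = Max ((\<lambda>c. h (b c)) ` C)" by auto
  obtain c' where c': "c' \<in> C" "b c \<in> U c'" using C b c(1) by blast
  have "h (b c) < h (b c')" using c' U b c(1) C(1) by blast
  moreover have "h (b c') \<le> h (b c)" unfolding c(2) using C(2) c'(1) by (intro Max_ge) auto
  ultimately show False by simp
qed

lemma upper_semicontinuous_on_add_real:
  fixes f :: "'a::topological_space \<Rightarrow> ereal" and u :: "'a \<Rightarrow> real"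
  assumes "upper_semicontinuous_on K f" "upper_semicontinuous_on K u"
  shows "upper_semicontinuous_on K (\<lambda>x. f x + ereal (u x))"
  unfolding upper_semicontinuous_on_def
proof (intro ballI allI impI)
  fix x a assume x: "x \<in> K" and a: "f x + ereal (u x) < a"
  then have "f x < a - ereal (u x)" by (simp add: ereal_less_minus)
  \<comment> \<open>The bound \<open>a\<close> is split into real thresholds \<open>b\<close> and
    \<open>d\<close> with sum below \<open>a\<close>, which avoids sums of opposite
    infinities.\<close>
  then obtain b where b: "f x < ereal b" "ereal b < a - ereal (u x)" using ereal_dense2 by blast
  then have "ereal (u x) < a - ereal b" by (simp add: ereal_less_minus add.commute)
  then obtain d where d: "ereal (u x) < ereal d" "ereal d < a - ereal b" using ereal_dense2 by blast
  have "\<forall>\<^sub>F y in at x within K. f y < ereal b" "\<forall>\<^sub>F y in at x within K. u y < d"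
    using assms x b(1) d(1) unfolding upper_semicontinuous_on_def by auto
  then show "\<forall>\<^sub>F y in at x within K. f y + ereal (u y) < a"
  proof eventually_elim
    case (elim y)
    then have "f y + ereal (u y) \<le> ereal b + ereal d" by (intro add_mono) auto
    also have "\<dots> < a" using d(2) by (cases a) auto
    finally show ?case .
  qed
qed

lemma continuous_on_imp_upper_semicontinuous_on:
  fixes u :: "'a::topological_space \<Rightarrow> real"
  assumes "continuous_on K u"
  shows "upper_semicontinuous_on K u"
  using assms unfolding upper_semicontinuous_on_def continuous_on_def by (auto intro: order_tendstoD(2))

lemma upper_semicontinuous_on_uminus_compose:
  fixes g :: "'b::topological_space \<Rightarrow> real"
  assumes g: "lower_semicontinuous_on UNIV g" and \<tau>: "continuous_on K \<tau>"
  shows "upper_semicontinuous_on K (\<lambda>x. - g (\<tau> x))"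
  unfolding upper_semicontinuous_on_def
proof (intro ballI allI impI)
  fix x a assume x: "x \<in> K" and a: "- g (\<tau> x) < a"
  then have "\<forall>\<^sub>F z in at (\<tau> x). - a < g z" using g unfolding lower_semicontinuous_on_def by auto
  \<comment> \<open>\<open>\<tau>\<close> may take the value \<open>\<tau> x\<close> at other points
    too, so the punctured neighbourhood has to be filled in.\<close>
  then have "\<forall>\<^sub>F z in nhds (\<tau> x). - a < g z"
    unfolding eventually_at_filter using a by (auto elim: eventually_mono)
  moreover have "filterlim \<tau> (nhds (\<tau> x)) (at x within K)" using \<tau> x by (auto simp: continuous_on_def)
  ultimately have "\<forall>\<^sub>F y in at x within K. - a < g (\<tau> y)" by (rule eventually_compose_filterlim)
  then show "\<forall>\<^sub>F y in at x within K. - g (\<tau> y) < a" by (auto elim: eventually_mono)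
qed

text \<open>Semicontinuity prevents the values along a convergent net from staying above a bound
  exceeding \<open>h \<mu>\<close>. Conversely, a maximizer is the limit of a constant net indexed
  by one point.\<close>

lemma generalized_maximizers_eq_maximizers:
  assumes usc: "upper_semicontinuous_on K h"
  shows "generalized_maximizers K h = maximizers K h"
proof (intro subset_antisym subsetI)
  fix \<mu> assume "\<mu> \<in> generalized_maximizers K h"
  then obtain J :: "('a set \<times> 'a) set" and le m where
    \<mu>: "\<mu> \<in> K" and dir: "directed_set J le" and m: "m ` J \<subseteq> K"
    and lim: "(m \<longlongrightarrow> \<mu>) (net_filter J le)"
    and limh: "((\<lambda>j. h (m j)) \<longlongrightarrow> (SUP \<nu>\<in>K. h \<nu>)) (net_filter J le)"
    unfolding generalized_maximizers_def by blast
  have "\<not> h \<mu> < (SUP \<nu>\<in>K. h \<nu>)"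
  proof
    assume "h \<mu> < (SUP \<nu>\<in>K. h \<nu>)"
    then obtain a where a: "h \<mu> < a" "a < (SUP \<nu>\<in>K. h \<nu>)" using dense by blast
    obtain U where U: "open U" "\<mu> \<in> U" "\<And>y. y \<in> U \<Longrightarrow> y \<in> K \<Longrightarrow> h y < a"
      using upper_semicontinuous_onE[OF usc \<mu> a(1)] by blast
    have "\<forall>\<^sub>F j in net_filter J le. m j \<in> U" using lim U by (simp add: topological_tendstoD)
    moreover have "\<forall>\<^sub>F j in net_filter J le. a < h (m j)" using limh a(2) by (rule order_tendstoD)
    ultimately have "\<forall>\<^sub>F j in net_filter J le. m j \<in> U \<and> a < h (m j)" by (rule eventually_conj)
    then obtain j where "j \<in> J" "m j \<in> U" "a < h (m j)"
      using dir unfolding eventually_net_filter[OF dir] directed_set_def by blast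
    then show False using U(3)[of "m j"] m by auto
  qed
  then show "\<mu> \<in> maximizers K h"
    using \<mu> by (auto simp: maximizers_def not_less intro: antisym SUP_upper)
next
  fix \<mu> assume "\<mu> \<in> maximizers K h"
  then have "\<mu> \<in> K" "h \<mu> = (SUP \<nu>\<in>K. h \<nu>)" by (auto simp: maximizers_def)
  moreover have "directed_set {()} (\<lambda>_ _. True)" by (simp add: directed_set_def)
  ultimately show "\<mu> \<in> generalized_maximizers K h"
    by (intro generalized_maximizersI[where m = "\<lambda>_. \<mu>" and J = "{()}" and le = "\<lambda>_ _. True"]) auto
qed

text \<open>One-sided difference quotients dominate every subgradient, so it lies below the
  derivative; the direction \<open>- h\<close> gives equality.\<close>

lemma gateaux_differentiable_subgradient_unique:
  assumes "gateaux_differentiable g" "x \<in> subdifferential g z" "y \<in> subdifferential g z"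
  shows "x = y"
proof -
  obtain D :: "'a dual" where D: "\<And>h. ((\<lambda>t. (g (z + t *\<^sub>R h) - g z) / t) \<longlongrightarrow> blinfun_apply D h) (at 0)"
    using assms(1) unfolding gateaux_differentiable_def by blast
  have le: "blinfun_apply w h \<le> blinfun_apply D h" if "w \<in> subdifferential g z" for w h
  proof (rule tendsto_lowerbound[OF filterlim_mono[OF D order_refl]])
    show "at_right 0 \<le> (at (0::real))" by (simp add: at_le)
    have "blinfun_apply w h \<le> (g (z + t *\<^sub>R h) - g z) / t" if "t > 0" for t
    proof -
      have "blinfun_apply w (z + t *\<^sub>R h - z) \<le> g (z + t *\<^sub>R h) - g z"
        using \<open>w \<in> _\<close> unfolding subdifferential_def by blast
      then show ?thesis using that by (simp add: blinfun.scaleR_right field_simps)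
    qed
    then show "\<forall>\<^sub>F t in at_right 0. blinfun_apply w h \<le> (g (z + t *\<^sub>R h) - g z) / t"
      by (auto simp: eventually_at_right_less intro: eventually_mono[OF eventually_at_right_less])
  qed simp
  have "w = D" if "w \<in> subdifferential g z" for w
  proof (rule blinfun_eqI)
    fix h show "blinfun_apply w h = blinfun_apply D h"
      using le[OF that, of h] le[OF that, of "- h"] by (simp add: blinfun.minus_right)
  qed
  then show ?thesis using assms by metis
qed

lemma norm_le_sup_norm_on:
  assumes "compact K" "continuous_on K \<tau>" "x \<in> K"
  shows "norm (\<tau> x) \<le> sup_norm_on K \<tau>"
proof -
  have "bounded (\<tau> ` K)" using assms by (intro compact_imp_bounded compact_continuous_image)
  then have "bdd_above ((\<lambda>x. norm (\<tau> x)) ` K)"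
    unfolding bounded_iff by (auto intro: bdd_aboveI2)
  then show ?thesis unfolding sup_norm_on_def using assms(3) by (intro cSUP_upper)
qed

section \<open>Convex functions bounded on bounded sets\<close>

lemma convex_on_bounded_imp_continuous_on_UNIV:
  fixes g :: "'a::real_normed_vector \<Rightarrow> real"
  assumes cvx: "convex_on UNIV g" and bd: "\<forall>B. bounded B \<longrightarrow> bounded (g ` B)"
  shows "continuous_on UNIV g"
proof -
  have "isCont g x" for x
  proof -
    have "bounded (g ` ball x 1)" using bd bounded_ball by blast
    then obtain b where "\<And>z. z \<in> ball x 1 \<Longrightarrow> \<bar>g z\<bar> \<le> b"
      unfolding bounded_iff by (metis imageI real_norm_def)
    then have "continuous_on (ball x 1) g"
      using convex_on_subset[OF cvx] by (intro convex_on_bounded_continuous[where b = b]) auto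
    then show ?thesis by (simp add: continuous_on_eq_continuous_at)
  qed
  then show ?thesis by (simp add: continuous_at_imp_continuous_on)
qed

lemma convex_on_bounded_imp_subdifferential_nonempty:
  fixes g :: "'a::real_normed_vector \<Rightarrow> real"
  assumes cvx: "convex_on UNIV g" and bd: "\<forall>B. bounded B \<longrightarrow> bounded (g ` B)"
  shows "subdifferential g x \<noteq> {}"
proof -
  have "bounded (g ` cball x 1)" using bd bounded_cball by blast
  then obtain b where "\<And>z. z \<in> cball x 1 \<Longrightarrow> \<bar>g z\<bar> \<le> b"
    unfolding bounded_iff by (metis imageI real_norm_def)
  then have "g (x + z) \<le> b" if "norm z \<le> 1" for z
    using that by (force simp: dist_norm dest: abs_le_D1)
  then show ?thesis by (rule subdifferential_nonempty[OF cvx zero_less_one])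
qed

lemma lower_semicontinuous_on_blinfun: "lower_semicontinuous_on S (blinfun_apply y)"
  for y :: "'a::real_normed_vector dual"
proof -
  have "continuous_on S (blinfun_apply y)" by (intro continuous_intros)
  then show ?thesis
    unfolding lower_semicontinuous_on_def continuous_on_def by (auto intro: order_tendstoD(1))
qed

section \<open>The nonlinear functional\<close>

locale concave_functional =
  fixes K :: "'v::{real_tvs, t2_space} set"
    and \<tau>p :: "'v \<Rightarrow> 'p::real_normed_vector" and \<tau>m :: "'v \<Rightarrow> 'm::real_normed_vector"
    and f :: "'v \<Rightarrow> ereal"
  assumes K: "K \<noteq> {}" "compact K" "convex K"
    and \<tau>p: "continuous_on K \<tau>p" "affine_map_on K \<tau>p"
    and \<tau>m: "continuous_on K \<tau>m" "affine_map_on K \<tau>m"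
    and f: "\<forall>\<mu>\<in>K. f \<mu> \<noteq> \<infinity>" "\<exists>\<mu>\<in>K. f \<mu> \<noteq> -\<infinity>"
    and usc_f: "upper_semicontinuous_on K f" and concave_f: "ereal_concave_on K f"
begin

text \<open>The effective domain of \<open>f\<close>. Elsewhere on \<open>K\<close> the functionals
  are \<open>-\<infinity>\<close>, so maximization becomes a real-valued problem on this
  set.\<close>

definition "D = {\<mu>\<in>K. f \<mu> \<noteq> -\<infinity>}"

text \<open>Outside \<open>D\<close> this has the junk value \<open>real_of_ereal (-\<infinity>) = 0\<close>.\<close>

definition "fr \<mu> = real_of_ereal (f \<mu>)"

text \<open>The convex parts remain arguments: bounded linear functionals in place of both give the
  linearised functional, and in place of \<open>gp\<close> alone the concave intermediate
  one.\<close>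

definition "Fr gp gm \<mu> = fr \<mu> - gm (\<tau>m \<mu>) + gp (\<tau>p \<mu>)"

text \<open>The conversion to a real is faithful for continuous \<open>gp\<close> and lower
  semicontinuous \<open>gm\<close>, by \<open>SUP_F_nl\<close>.\<close>

definition "Fmax gp gm = real_of_ereal (SUP \<mu>\<in>K. F_nl f \<tau>p \<tau>m gp gm \<mu>)"

lemma D_subset: "\<mu> \<in> D \<Longrightarrow> \<mu> \<in> K"
  by (simp add: D_def)

lemma ereal_fr: "\<mu> \<in> D \<Longrightarrow> f \<mu> = ereal (fr \<mu>)"
  using f by (cases "f \<mu>") (auto simp: D_def fr_def)

lemma F_nl_eq: "\<mu> \<in> D \<Longrightarrow> F_nl f \<tau>p \<tau>m gp gm \<mu> = ereal (Fr gp gm \<mu>)"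
  by (simp add: F_nl_def ereal_fr Fr_def)

lemma F_nl_eq_MInf: "\<mu> \<in> K \<Longrightarrow> \<mu> \<notin> D \<Longrightarrow> F_nl f \<tau>p \<tau>m gp gm \<mu> = -\<infinity>"
  by (simp add: F_nl_def D_def)

lemma G_lin_eq_F_nl: "G_lin f \<tau>p \<tau>m yp ym = F_nl f \<tau>p \<tau>m (blinfun_apply yp) (blinfun_apply ym)"
  by (simp add: G_lin_def[abs_def] F_nl_def[abs_def])

lemma concave_on_fr: "concave_on D fr"
  unfolding concave_on_iff
proof (intro conjI ballI allI impI)
  \<comment> \<open>A real lower bound for \<open>f\<close> at the combination keeps it in
    \<open>D\<close>, so convexity of \<open>D\<close> and concavity are obtained together.\<close>
  have mix: "u *\<^sub>R x + v *\<^sub>R y \<in> D \<and> u * fr x + v * fr y \<le> fr (u *\<^sub>R x + v *\<^sub>R y)"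
    if "x \<in> D" "y \<in> D" "u \<ge> 0" "v \<ge> 0" "u + v = 1" for x y u v
  proof -
    have uv: "u = 1 - v" "v \<in> {0..1}" using that by auto
    have "ereal u * f x + ereal v * f y \<le> f (u *\<^sub>R x + v *\<^sub>R y)"
      using concave_f D_subset[OF that(1)] D_subset[OF that(2)] uv
      unfolding ereal_concave_on_def by blast
    then have *: "ereal (u * fr x + v * fr y) \<le> f (u *\<^sub>R x + v *\<^sub>R y)"
      using that by (simp add: ereal_fr)
    moreover have "u *\<^sub>R x + v *\<^sub>R y \<in> K"
      using K(3) that D_subset by (auto simp: convex_def)
    ultimately have "u *\<^sub>R x + v *\<^sub>R y \<in> D" by (auto simp: D_def)
    then show ?thesis using * by (simp add: ereal_fr)
  qed
  then show "convex D" by (auto simp: convex_def)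
  show "u * fr x + v * fr y \<le> fr (u *\<^sub>R x + v *\<^sub>R y)"
    if "x \<in> D" "y \<in> D" "u \<ge> 0" "v \<ge> 0" "u + v = 1" for x y u v
    using mix[OF that] by simp
qed

lemma convex_comb_D:
  assumes "x \<in> D" "y \<in> D" "u \<ge> 0" "v \<ge> 0" "u + v = 1"
  shows "u *\<^sub>R x + v *\<^sub>R y \<in> D" "\<tau>p (u *\<^sub>R x + v *\<^sub>R y) = u *\<^sub>R \<tau>p x + v *\<^sub>R \<tau>p y"
    "\<tau>m (u *\<^sub>R x + v *\<^sub>R y) = u *\<^sub>R \<tau>m x + v *\<^sub>R \<tau>m y"
proof -
  have uv: "u = 1 - v" "v \<in> {0..1}" using assms by auto
  show "u *\<^sub>R x + v *\<^sub>R y \<in> D" using concave_on_fr assms by (auto simp: concave_on_iff convex_def)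
  show "\<tau>p (u *\<^sub>R x + v *\<^sub>R y) = u *\<^sub>R \<tau>p x + v *\<^sub>R \<tau>p y"
    using \<tau>p(2) D_subset[OF assms(1)] D_subset[OF assms(2)] uv unfolding affine_map_on_def by blast
  show "\<tau>m (u *\<^sub>R x + v *\<^sub>R y) = u *\<^sub>R \<tau>m x + v *\<^sub>R \<tau>m y"
    using \<tau>m(2) D_subset[OF assms(1)] D_subset[OF assms(2)] uv unfolding affine_map_on_def by blast
qed

lemma upper_semicontinuous_on_F_nl:
  assumes "continuous_on UNIV gp" "lower_semicontinuous_on UNIV gm"
  shows "upper_semicontinuous_on K (F_nl f \<tau>p \<tau>m gp gm)"
proof -
  have "upper_semicontinuous_on K (\<lambda>\<mu>. gp (\<tau>p \<mu>))"
    using assms(1) \<tau>p(1)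
    by (intro continuous_on_imp_upper_semicontinuous_on) (auto intro: continuous_on_compose2)
  moreover have "upper_semicontinuous_on K (\<lambda>\<mu>. - gm (\<tau>m \<mu>))"
    by (rule upper_semicontinuous_on_uminus_compose[OF assms(2) \<tau>m(1)])
  ultimately have "upper_semicontinuous_on K
      (\<lambda>\<mu>. f \<mu> + ereal (- gm (\<tau>m \<mu>)) + ereal (gp (\<tau>p \<mu>)))"
    using usc_f by (intro upper_semicontinuous_on_add_real)
  then show ?thesis by (simp add: F_nl_def[abs_def] minus_ereal_def)
qed

context
  fixes gp :: "'p \<Rightarrow> real" and gm :: "'m \<Rightarrow> real"
  assumes cont: "continuous_on UNIV gp" and lsc: "lower_semicontinuous_on UNIV gm"
begin

text \<open>Upper semicontinuity on a compact set gives a maximizer; as \<open>f\<close> is finite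
  somewhere, the maximizer lies in \<open>D\<close> and the supremum is real.\<close>

lemma F_nl_maximum:
  obtains \<mu> where "\<mu> \<in> D" "(SUP \<nu>\<in>K. F_nl f \<tau>p \<tau>m gp gm \<nu>) = ereal (Fr gp gm \<mu>)"
proof -
  obtain \<mu> where \<mu>: "\<mu> \<in> K" "\<And>\<nu>. \<nu> \<in> K \<Longrightarrow> F_nl f \<tau>p \<tau>m gp gm \<nu> \<le> F_nl f \<tau>p \<tau>m gp gm \<mu>"
    using upper_semicontinuous_on_attains_sup[OF K(2,1) upper_semicontinuous_on_F_nl[OF cont lsc]]
    by blast
  obtain \<mu>0 where "\<mu>0 \<in> D" using f(2) by (auto simp: D_def)
  then have "\<mu> \<in> D"
    using \<mu>(1) \<mu>(2)[of \<mu>0] D_subset F_nl_eq F_nl_eq_MInf by fastforce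
  moreover have "(SUP \<nu>\<in>K. F_nl f \<tau>p \<tau>m gp gm \<nu>) = F_nl f \<tau>p \<tau>m gp gm \<mu>"
    using \<mu> by (intro antisym SUP_least SUP_upper)
  ultimately show ?thesis by (intro that[of \<mu>]) (simp_all add: F_nl_eq)
qed

lemma SUP_F_nl: "(SUP \<nu>\<in>K. F_nl f \<tau>p \<tau>m gp gm \<nu>) = ereal (Fmax gp gm)"
  using F_nl_maximum unfolding Fmax_def by (metis real_of_ereal.simps(1))

lemma Fr_le_Fmax: "\<nu> \<in> D \<Longrightarrow> Fr gp gm \<nu> \<le> Fmax gp gm"
  using SUP_upper[of \<nu> K "F_nl f \<tau>p \<tau>m gp gm"] by (simp add: SUP_F_nl F_nl_eq D_subset)

lemma Fmax_attained: obtains \<mu> where "\<mu> \<in> D" "Fr gp gm \<mu> = Fmax gp gm"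
  using F_nl_maximum SUP_F_nl by (metis ereal.inject)

lemma maximizers_F_nl:
  "maximizers K (F_nl f \<tau>p \<tau>m gp gm) = {\<mu>\<in>D. Fr gp gm \<mu> = Fmax gp gm}"
proof -
  have "F_nl f \<tau>p \<tau>m gp gm \<mu> = ereal (Fmax gp gm) \<longleftrightarrow> \<mu> \<in> D \<and> Fr gp gm \<mu> = Fmax gp gm"
    if "\<mu> \<in> K" for \<mu>
    using F_nl_eq F_nl_eq_MInf[OF that] by (cases "\<mu> \<in> D") auto
  then show ?thesis unfolding maximizers_def SUP_F_nl using D_subset by blast
qed

lemma maximizers_F_nl_nonempty: "maximizers K (F_nl f \<tau>p \<tau>m gp gm) \<noteq> {}"
  using Fmax_attained maximizers_F_nl by blast

lemma compact_maximizers_F_nl: "compact (maximizers K (F_nl f \<tau>p \<tau>m gp gm))"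
proof -
  have "maximizers K (F_nl f \<tau>p \<tau>m gp gm) =
      {\<mu>\<in>K. (SUP \<nu>\<in>K. F_nl f \<tau>p \<tau>m gp gm \<nu>) \<le> F_nl f \<tau>p \<tau>m gp gm \<mu>}"
    by (auto simp: maximizers_def intro: antisym SUP_upper)
  then show ?thesis
    using compact_superlevel[OF K(2) upper_semicontinuous_on_F_nl[OF cont lsc]] by simp
qed

end

lemma continuous_on_dual: "continuous_on UNIV (blinfun_apply xp)" for xp :: "'p dual"
  by (intro continuous_intros)

lemma P_L_eq: "P_L K f \<tau>p \<tau>m yp ym = ereal (Fmax (blinfun_apply yp) (blinfun_apply ym))"
  unfolding P_L_def G_lin_eq_F_nl
  by (rule SUP_F_nl[OF continuous_on_dual lower_semicontinuous_on_blinfun])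

lemma maximizers_G_lin: "maximizers K (G_lin f \<tau>p \<tau>m yp ym) =
    {\<mu>\<in>D. Fr (blinfun_apply yp) (blinfun_apply ym) \<mu> = Fmax (blinfun_apply yp) (blinfun_apply ym)}"
  unfolding G_lin_eq_F_nl
  by (rule maximizers_F_nl[OF continuous_on_dual lower_semicontinuous_on_blinfun])

text \<open>Along a segment the functional is affine, so a maximum at an interior point forces both
  endpoints to be maximizers, against uniqueness.\<close>

lemma singleton_maximizers_G_lin_extreme:
  assumes affine: "ereal_affine_on K f" and single: "is_singleton (maximizers K (G_lin f \<tau>p \<tau>m yp ym))"
    and \<nu>: "\<nu> \<in> maximizers K (G_lin f \<tau>p \<tau>m yp ym)"
  shows "\<nu> extreme_point_of K"
  unfolding extreme_point_of_def
proof (intro conjI ballI notI)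
  let ?F = "Fr (blinfun_apply yp) (blinfun_apply ym)" and ?M = "Fmax (blinfun_apply yp) (blinfun_apply ym)"
  show "\<nu> \<in> K" using \<nu> by (simp add: maximizers_def)
  have \<nu>D: "\<nu> \<in> D" "?F \<nu> = ?M" using \<nu> unfolding maximizers_G_lin by auto
  fix a b assume ab: "a \<in> K" "b \<in> K" and "\<nu> \<in> open_segment a b"
  then obtain t where "a \<noteq> b" and t: "0 < t" "t < 1" and \<nu>_eq: "\<nu> = (1 - t) *\<^sub>R a + t *\<^sub>R b"
    by (auto simp: in_segment)
  have f\<nu>: "f \<nu> = ereal (1 - t) * f a + ereal t * f b"
    unfolding \<nu>_eq using affine ab t unfolding ereal_affine_on_def by auto
  \<comment> \<open>Both weights are positive, so a value \<open>-\<infinity>\<close> at an endpoint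
    would make \<open>f \<nu>\<close> infinite.\<close>
  then have abD: "a \<in> D" "b \<in> D"
    using f(1) ab t \<nu>D(1) unfolding D_def by (cases "f a"; cases "f b"; force)+
  then have "fr \<nu> = (1 - t) * fr a + t * fr b" using f\<nu> \<nu>D(1) by (simp add: ereal_fr)
  moreover have "\<tau>p \<nu> = (1 - t) *\<^sub>R \<tau>p a + t *\<^sub>R \<tau>p b" "\<tau>m \<nu> = (1 - t) *\<^sub>R \<tau>m a + t *\<^sub>R \<tau>m b"
    unfolding \<nu>_eq using convex_comb_D[OF abD, of "1 - t" t] t by auto
  ultimately have "?F \<nu> = (1 - t) * ?F a + t * ?F b"
    unfolding Fr_def by (simp only: blinfun.add_right blinfun.scaleR_right)
      (simp add: algebra_simps)
  \<comment> \<open>Two nonnegative deficits with sum zero both vanish.\<close>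
  then have "(1 - t) * (?M - ?F a) + t * (?M - ?F b) = 0" using \<nu>D(2) by (simp add: algebra_simps)
  moreover have "0 \<le> (1 - t) * (?M - ?F a)" "0 \<le> t * (?M - ?F b)"
    using Fr_le_Fmax[OF continuous_on_dual lower_semicontinuous_on_blinfun] abD t by auto
  ultimately have "(1 - t) * (?M - ?F a) = 0" "t * (?M - ?F b) = 0" by linarith+
  then have "a \<in> maximizers K (G_lin f \<tau>p \<tau>m yp ym)" "b \<in> maximizers K (G_lin f \<tau>p \<tau>m yp ym)"
    unfolding maximizers_G_lin using abD t by auto
  then show False using single \<open>a \<noteq> b\<close> by (auto simp: is_singleton_def)
qed

end

section \<open>Duality in \<open>gm\<close> for a fixed slope \<open>xp\<close>\<close>

locale concave_minus_convex = concave_functional K \<tau>p \<tau>m f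
  for K :: "'v::{real_tvs, t2_space} set"
    and \<tau>p :: "'v \<Rightarrow> 'p::real_normed_vector" and \<tau>m :: "'v \<Rightarrow> 'm::real_normed_vector"
    and f :: "'v \<Rightarrow> ereal" +
  fixes gm :: "'m \<Rightarrow> real"
  assumes lsc_gm: "lower_semicontinuous_on UNIV gm" and convex_gm: "convex_on UNIV gm"
    and dom_gm: "effective_domain (legendre_fenchel gm) \<noteq> {}"
    and growth_gm: "minimal_linear_growth (legendre_fenchel gm) (sup_norm_on K \<tau>m)"
begin

text \<open>Weak duality: Young's inequality at a maximizer of the functional with \<open>xp\<close>
  and \<open>gm\<close>.\<close>

lemma Fmax_le_dual:
  "ereal (Fmax (blinfun_apply xp) gm) \<le>
    ereal (Fmax (blinfun_apply xp) (blinfun_apply ym)) + legendre_fenchel gm ym"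
proof -
  obtain \<nu> where \<nu>: "\<nu> \<in> D" "Fr (blinfun_apply xp) gm \<nu> = Fmax (blinfun_apply xp) gm"
    by (rule Fmax_attained[OF continuous_on_dual lsc_gm])
  have "Fmax (blinfun_apply xp) gm =
      Fr (blinfun_apply xp) (blinfun_apply ym) \<nu> + (blinfun_apply ym (\<tau>m \<nu>) - gm (\<tau>m \<nu>))"
    using \<nu>(2) by (simp add: Fr_def)
  moreover have "ereal (blinfun_apply ym (\<tau>m \<nu>) - gm (\<tau>m \<nu>)) \<le> legendre_fenchel gm ym"
    unfolding legendre_fenchel_def by (rule SUP_upper) simp
  ultimately show ?thesis
    using Fr_le_Fmax[OF continuous_on_dual lower_semicontinuous_on_blinfun \<nu>(1), of xp ym]
    by (simp add: add_mono flip: plus_ereal.simps(1))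
qed

text \<open>Strong duality with attainment: Fenchel duality on \<open>D\<close> for the concave
  function \<open>fr + xp \<circ> \<tau>p\<close>.\<close>

lemma Fmax_dual_attained:
  obtains ym where "ereal (Fmax (blinfun_apply xp) (blinfun_apply ym)) + legendre_fenchel gm ym
    \<le> ereal (Fmax (blinfun_apply xp) gm)"
proof -
  let ?h = "\<lambda>\<mu>. fr \<mu> + blinfun_apply xp (\<tau>p \<mu>)"
  have "D \<noteq> {}" using f(2) by (auto simp: D_def)
  moreover have "concave_on D ?h"
    unfolding concave_on_iff
  proof (intro conjI ballI allI impI)
    show "convex D" using concave_on_fr by (simp add: concave_on_iff)
    fix x y and u v :: real assume *: "x \<in> D" "y \<in> D" "u \<ge> 0" "v \<ge> 0" "u + v = 1"
    then have "u * fr x + v * fr y \<le> fr (u *\<^sub>R x + v *\<^sub>R y)"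
      using concave_on_fr by (simp add: concave_on_iff)
    then show "u * ?h x + v * ?h y \<le> ?h (u *\<^sub>R x + v *\<^sub>R y)"
      using convex_comb_D(2)[OF *] by (simp add: blinfun.add_right blinfun.scaleR_right algebra_simps)
  qed
  moreover have "affine_map_on D \<tau>m"
    using \<tau>m(2) D_subset by (simp add: affine_map_on_def)
  ultimately have "\<exists>y. \<forall>\<mu>\<in>D. \<forall>x.
      ?h \<mu> - blinfun_apply y (\<tau>m \<mu>) + blinfun_apply y x - gm x \<le> Fmax (blinfun_apply xp) gm"
  proof (rule fenchel_duality[OF _ _ _ _ convex_gm lsc_gm dom_gm growth_gm])
    show "norm (\<tau>m \<mu>) \<le> sup_norm_on K \<tau>m" if "\<mu> \<in> D" for \<mu>
      by (rule norm_le_sup_norm_on[OF K(2) \<tau>m(1) D_subset[OF that]])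
    show "?h \<mu> - gm (\<tau>m \<mu>) \<le> Fmax (blinfun_apply xp) gm" if "\<mu> \<in> D" for \<mu>
      using Fr_le_Fmax[OF continuous_on_dual lsc_gm that, of xp] by (simp add: Fr_def)
  qed
  then obtain y where y: "\<And>\<mu> x. \<mu> \<in> D \<Longrightarrow>
      ?h \<mu> - blinfun_apply y (\<tau>m \<mu>) + blinfun_apply y x - gm x \<le> Fmax (blinfun_apply xp) gm"
    by blast
  \<comment> \<open>Taken at a maximizer of the linearised functional, the inequality for
    \<open>y\<close> becomes a bound on the conjugate.\<close>
  obtain \<mu> where \<mu>: "\<mu> \<in> D" "Fr (blinfun_apply xp) (blinfun_apply y) \<mu> = Fmax (blinfun_apply xp) (blinfun_apply y)"
    by (rule Fmax_attained[OF continuous_on_dual lower_semicontinuous_on_blinfun])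
  have "legendre_fenchel gm y \<le>
      ereal (Fmax (blinfun_apply xp) gm - Fmax (blinfun_apply xp) (blinfun_apply y))"
    unfolding legendre_fenchel_le_iff affine_minorant_def
    using y[OF \<mu>(1)] \<mu>(2) by (simp add: Fr_def algebra_simps)
  then have "ereal (Fmax (blinfun_apply xp) (blinfun_apply y)) + legendre_fenchel gm y \<le>
      ereal (Fmax (blinfun_apply xp) (blinfun_apply y)) +
      ereal (Fmax (blinfun_apply xp) gm - Fmax (blinfun_apply xp) (blinfun_apply y))"
    by (rule add_left_mono)
  then show ?thesis by (intro that[of y]) simp
qed

text \<open>With the linear \<open>xp\<close> in place of \<open>gp\<close>, the functional is
  concave on \<open>D\<close>.\<close>

lemma convex_maximizers_F_nl: "convex (maximizers K (F_nl f \<tau>p \<tau>m (blinfun_apply xp) gm))"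
  unfolding maximizers_F_nl[OF continuous_on_dual lsc_gm]
proof (rule convexI)
  let ?F = "Fr (blinfun_apply xp) gm" and ?T = "Fmax (blinfun_apply xp) gm"
  fix x y and u v :: real
  assume xy: "x \<in> {\<mu>\<in>D. ?F \<mu> = ?T}" "y \<in> {\<mu>\<in>D. ?F \<mu> = ?T}"
    and uv: "0 \<le> u" "0 \<le> v" "u + v = 1"
  then have D: "x \<in> D" "y \<in> D" by auto
  note comb = convex_comb_D[OF D uv]
  have "u * fr x + v * fr y \<le> fr (u *\<^sub>R x + v *\<^sub>R y)"
    using concave_on_fr D uv by (simp add: concave_on_iff)
  moreover have "gm (\<tau>m (u *\<^sub>R x + v *\<^sub>R y)) \<le> u * gm (\<tau>m x) + v * gm (\<tau>m y)"
    unfolding comb(3) by (rule convex_on_UNIV_D[OF convex_gm uv])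
  ultimately have "u * ?F x + v * ?F y \<le> ?F (u *\<^sub>R x + v *\<^sub>R y)"
    unfolding Fr_def comb(2) by (simp add: blinfun.add_right blinfun.scaleR_right algebra_simps)
  moreover have "u * ?F x + v * ?F y = ?T"
    using xy uv by (simp flip: distrib_right)
  ultimately have "?F (u *\<^sub>R x + v *\<^sub>R y) = ?T"
    using Fr_le_Fmax[OF continuous_on_dual lsc_gm comb(1), of xp] by linarith
  then show "u *\<^sub>R x + v *\<^sub>R y \<in> {\<mu>\<in>D. ?F \<mu> = ?T}" using comb(1) by simp
qed

context
  fixes gp :: "'p \<Rightarrow> real" and xp :: "'p dual" and c :: real
  assumes conj_gp: "legendre_fenchel gp xp = ereal c"
begin

text \<open>Weak duality bounds the infimum from below and the attained dual bounds it from above;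
  finiteness of \<open>c\<close> makes the subtraction harmless.\<close>

lemma P_flat_eq: "P_flat K f \<tau>p \<tau>m gp gm xp = ereal (Fmax (blinfun_apply xp) gm - c)"
  unfolding P_flat_def P_NL_def P_L_eq conj_gp
proof (intro antisym INF_greatest)
  fix ym
  have "ereal (Fmax (blinfun_apply xp) gm) - ereal c \<le>
      ereal (Fmax (blinfun_apply xp) (blinfun_apply ym)) + legendre_fenchel gm ym - ereal c"
    using Fmax_le_dual by (intro ereal_minus_mono) auto
  then show "ereal (Fmax (blinfun_apply xp) gm - c) \<le>
      ereal (Fmax (blinfun_apply xp) (blinfun_apply ym)) + legendre_fenchel gm ym - ereal c" by simp
next
  obtain ym where "ereal (Fmax (blinfun_apply xp) (blinfun_apply ym)) + legendre_fenchel gm ym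
      \<le> ereal (Fmax (blinfun_apply xp) gm)"
    by (rule Fmax_dual_attained)
  then have "ereal (Fmax (blinfun_apply xp) (blinfun_apply ym)) + legendre_fenchel gm ym - ereal c
      \<le> ereal (Fmax (blinfun_apply xp) gm) - ereal c"
    by (intro ereal_minus_mono) auto
  then show "(INF ym. ereal (Fmax (blinfun_apply xp) (blinfun_apply ym)) + legendre_fenchel gm ym - ereal c)
      \<le> ereal (Fmax (blinfun_apply xp) gm - c)"
    by (intro INF_lower2[of ym]) auto
qed

lemma M_flat_iff: "ym \<in> M_flat K f \<tau>p \<tau>m gp gm xp \<longleftrightarrow>
    legendre_fenchel gm ym = ereal (Fmax (blinfun_apply xp) gm - Fmax (blinfun_apply xp) (blinfun_apply ym))"
  unfolding M_flat_def P_flat_eq P_NL_def P_L_eq conj_gp mem_Collect_eq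
  by (cases "legendre_fenchel gm ym") auto

lemma M_flat_nonempty: "M_flat K f \<tau>p \<tau>m gp gm xp \<noteq> {}"
proof -
  obtain ym where "ereal (Fmax (blinfun_apply xp) (blinfun_apply ym)) + legendre_fenchel gm ym
      \<le> ereal (Fmax (blinfun_apply xp) gm)"
    by (rule Fmax_dual_attained)
  then have "ereal (Fmax (blinfun_apply xp) (blinfun_apply ym)) + legendre_fenchel gm ym
      = ereal (Fmax (blinfun_apply xp) gm)"
    using Fmax_le_dual by (intro antisym)
  then have "ym \<in> M_flat K f \<tau>p \<tau>m gp gm xp"
    unfolding M_flat_iff by (cases "legendre_fenchel gm ym") auto
  then show ?thesis by blast
qed

text \<open>The value at \<open>\<nu>\<close> with \<open>gm\<close> splits into a linearised value,
  at most \<open>?P\<close>, and a Young term, at most \<open>?T - ?P\<close>. The sum is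
  \<open>?T\<close> exactly if both bounds are attained, the second meaning that \<open>xm\<close>
  is a subgradient. The resulting set does not involve \<open>xm\<close>.\<close>

lemma E_sc_eq_maximizers:
  assumes "xm \<in> M_flat K f \<tau>p \<tau>m gp gm xp"
  shows "E_sc K f \<tau>p \<tau>m gm xp xm = maximizers K (F_nl f \<tau>p \<tau>m (blinfun_apply xp) gm)"
proof -
  let ?T = "Fmax (blinfun_apply xp) gm" and ?P = "Fmax (blinfun_apply xp) (blinfun_apply xm)"
  have conj_gm: "legendre_fenchel gm xm = ereal (?T - ?P)" using assms by (simp add: M_flat_iff)
  then have minorant: "\<And>x. blinfun_apply xm x - (?T - ?P) \<le> gm x"
    using legendre_fenchel_le_iff[of gm xm "?T - ?P"] by (simp add: affine_minorant_def)
  have "Fr (blinfun_apply xp) (blinfun_apply xm) \<nu> = ?P \<and> xm \<in> subdifferential gm (\<tau>m \<nu>) \<longleftrightarrow>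
      Fr (blinfun_apply xp) gm \<nu> = ?T" if \<nu>: "\<nu> \<in> D" for \<nu>
  proof
    assume *: "Fr (blinfun_apply xp) (blinfun_apply xm) \<nu> = ?P \<and> xm \<in> subdifferential gm (\<tau>m \<nu>)"
    then have "legendre_fenchel gm xm \<le> ereal (blinfun_apply xm (\<tau>m \<nu>) - gm (\<tau>m \<nu>))"
      unfolding legendre_fenchel_le_iff
      by (auto simp: affine_minorant_def subdifferential_def blinfun.diff_right algebra_simps)
    then have "?T \<le> Fr (blinfun_apply xp) gm \<nu>" using * by (simp add: conj_gm Fr_def)
    then show "Fr (blinfun_apply xp) gm \<nu> = ?T"
      using Fr_le_Fmax[OF continuous_on_dual lsc_gm \<nu>] by (intro antisym)
  next
    assume *: "Fr (blinfun_apply xp) gm \<nu> = ?T"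
    have le: "Fr (blinfun_apply xp) (blinfun_apply xm) \<nu> \<le> ?P"
      by (rule Fr_le_Fmax[OF continuous_on_dual lower_semicontinuous_on_blinfun \<nu>])
    have "Fr (blinfun_apply xp) gm \<nu> =
        Fr (blinfun_apply xp) (blinfun_apply xm) \<nu> + (blinfun_apply xm (\<tau>m \<nu>) - gm (\<tau>m \<nu>))"
      by (simp add: Fr_def)
    then have eq: "Fr (blinfun_apply xp) (blinfun_apply xm) \<nu> = ?P"
      "blinfun_apply xm (\<tau>m \<nu>) - gm (\<tau>m \<nu>) = ?T - ?P"
      using * le minorant[of "\<tau>m \<nu>"] by linarith+
    have "blinfun_apply xm (x - \<tau>m \<nu>) \<le> gm x - gm (\<tau>m \<nu>)" for x
      using minorant[of x] eq(2) unfolding blinfun.diff_right by linarith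
    with eq(1) show "Fr (blinfun_apply xp) (blinfun_apply xm) \<nu> = ?P \<and> xm \<in> subdifferential gm (\<tau>m \<nu>)"
      by (simp add: subdifferential_def)
  qed
  then show ?thesis
    unfolding E_sc_def maximizers_G_lin maximizers_F_nl[OF continuous_on_dual lsc_gm] by blast
qed

text \<open>The definite description is justified: some optimal \<open>xm\<close> exists, and all of
  them give the same set.\<close>

lemma E_sc_common_eq_maximizers:
  "E_sc_common K f \<tau>p \<tau>m gp gm xp = maximizers K (F_nl f \<tau>p \<tau>m (blinfun_apply xp) gm)"
  unfolding E_sc_common_def using M_flat_nonempty E_sc_eq_maximizers by (intro the_equality) auto

end

end

section \<open>Duality in \<open>gp\<close> and the joint maximization over slopes and
  points\<close>

locale concave_minus_plus_convex = concave_minus_convex K \<tau>p \<tau>m f gm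
  for K :: "'v::{real_tvs, t2_space} set"
    and \<tau>p :: "'v \<Rightarrow> 'p::real_normed_vector" and \<tau>m :: "'v \<Rightarrow> 'm::real_normed_vector"
    and f :: "'v \<Rightarrow> ereal" and gm :: "'m \<Rightarrow> real" +
  fixes gp :: "'p \<Rightarrow> real"
  assumes convex_gp: "convex_on UNIV gp"
    and bounded_gp: "\<forall>B. bounded B \<longrightarrow> bounded (gp ` B)"
    and dom_gp: "effective_domain (legendre_fenchel gp) = UNIV"
begin

definition "conj_gp xp = real_of_ereal (legendre_fenchel gp xp)"

lemma legendre_fenchel_gp: "legendre_fenchel gp xp = ereal (conj_gp xp)"
proof -
  have "legendre_fenchel gp xp < \<infinity>" using dom_gp by (auto simp: effective_domain_def)
  moreover have "ereal (blinfun_apply xp 0 - gp 0) \<le> legendre_fenchel gp xp"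
    unfolding legendre_fenchel_def by (rule SUP_upper) simp
  ultimately show ?thesis by (cases "legendre_fenchel gp xp") (auto simp: conj_gp_def)
qed

lemma young: "blinfun_apply xp z - conj_gp xp \<le> gp z"
  using legendre_fenchel_le_iff[of gp xp "conj_gp xp"] by (simp add: legendre_fenchel_gp affine_minorant_def)

text \<open>The equality case of Young's inequality.\<close>

lemma subdifferential_gp_iff: "xp \<in> subdifferential gp z \<longleftrightarrow> blinfun_apply xp z - conj_gp xp = gp z"
proof
  assume "xp \<in> subdifferential gp z"
  then have "legendre_fenchel gp xp \<le> ereal (blinfun_apply xp z - gp z)"
    unfolding legendre_fenchel_le_iff
    by (auto simp: affine_minorant_def subdifferential_def blinfun.diff_right algebra_simps)
  then show "blinfun_apply xp z - conj_gp xp = gp z"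
    using young[of xp z] by (simp add: legendre_fenchel_gp)
next
  assume "blinfun_apply xp z - conj_gp xp = gp z"
  then have "blinfun_apply xp (y - z) \<le> gp y - gp z" for y
    using young[of xp y] unfolding blinfun.diff_right by linarith
  then show "xp \<in> subdifferential gp z" by (simp add: subdifferential_def)
qed

lemma continuous_gp: "continuous_on UNIV gp"
  by (rule convex_on_bounded_imp_continuous_on_UNIV[OF convex_gp bounded_gp])

text \<open>Isolates the Young deficit of \<open>gp\<close>, which is nonnegative and vanishes
  exactly when \<open>xp\<close> is a subgradient. The comparisons below are read off from
  it.\<close>

lemma Fr_dual: "Fr (blinfun_apply xp) gm \<nu> - conj_gp xp = Fr gp gm \<nu> - (gp (\<tau>p \<nu>) - (blinfun_apply xp (\<tau>p \<nu>) - conj_gp xp))"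
  by (simp add: Fr_def)

lemma Fmax_dual_le: "Fmax (blinfun_apply xp) gm - conj_gp xp \<le> Fmax gp gm"
proof -
  obtain \<nu> where \<nu>: "\<nu> \<in> D" "Fr (blinfun_apply xp) gm \<nu> = Fmax (blinfun_apply xp) gm"
    by (rule Fmax_attained[OF continuous_on_dual lsc_gm])
  then show ?thesis
    using Fr_dual[of xp \<nu>] young[of xp "\<tau>p \<nu>"] Fr_le_Fmax[OF continuous_gp lsc_gm \<nu>(1)] by linarith
qed

text \<open>The deficit vanishes at \<open>\<nu>\<close>, so the value there already reaches the
  upper bound of \<open>Fmax_dual_le\<close>; both inequalities in between become
  equalities.\<close>

lemma maximizer_subgradient:
  assumes "\<nu> \<in> D" "Fr gp gm \<nu> = Fmax gp gm" "xp \<in> subdifferential gp (\<tau>p \<nu>)"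
  shows "Fmax (blinfun_apply xp) gm - conj_gp xp = Fmax gp gm"
    "Fr (blinfun_apply xp) gm \<nu> = Fmax (blinfun_apply xp) gm"
proof -
  have "Fr (blinfun_apply xp) gm \<nu> - conj_gp xp = Fmax gp gm"
    using Fr_dual[of xp \<nu>] assms(2,3) by (simp add: subdifferential_gp_iff)
  then show "Fmax (blinfun_apply xp) gm - conj_gp xp = Fmax gp gm"
    "Fr (blinfun_apply xp) gm \<nu> = Fmax (blinfun_apply xp) gm"
    using Fmax_dual_le[of xp] Fr_le_Fmax[OF continuous_on_dual lsc_gm assms(1), of xp] by linarith+
qed

text \<open>The value of the nonlinear functional at \<open>\<nu>\<close> is its maximum plus the
  Young deficit, so the deficit must vanish.\<close>

lemma dual_maximizer:
  assumes "\<nu> \<in> D" "Fr (blinfun_apply xp) gm \<nu> = Fmax (blinfun_apply xp) gm"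
    and "Fmax (blinfun_apply xp) gm - conj_gp xp = Fmax gp gm"
  shows "Fr gp gm \<nu> = Fmax gp gm" "xp \<in> subdifferential gp (\<tau>p \<nu>)"
  using Fr_dual[of xp \<nu>] young[of xp "\<tau>p \<nu>"] Fr_le_Fmax[OF continuous_gp lsc_gm assms(1)] assms(2,3)
  unfolding subdifferential_gp_iff by linarith+

text \<open>The upper bound holds for every slope and is attained by any subgradient of
  \<open>gp\<close> at the image of a maximizer.\<close>

lemma P_flat_sup_eq: "P_flat_sup K f \<tau>p \<tau>m gp gm = ereal (Fmax gp gm)"
  unfolding P_flat_sup_def P_flat_eq[OF legendre_fenchel_gp]
proof (rule antisym)
  show "(SUP yp. ereal (Fmax (blinfun_apply yp) gm - conj_gp yp)) \<le> ereal (Fmax gp gm)"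
    using Fmax_dual_le by (intro SUP_least) simp
  obtain \<nu> where \<nu>: "\<nu> \<in> D" "Fr gp gm \<nu> = Fmax gp gm"
    by (rule Fmax_attained[OF continuous_gp lsc_gm])
  obtain xp where "xp \<in> subdifferential gp (\<tau>p \<nu>)"
    using convex_on_bounded_imp_subdifferential_nonempty[OF convex_gp bounded_gp] by blast
  then have "Fmax (blinfun_apply xp) gm - conj_gp xp = Fmax gp gm"
    by (rule maximizer_subgradient(1)[OF \<nu>])
  then show "ereal (Fmax gp gm) \<le> (SUP yp. ereal (Fmax (blinfun_apply yp) gm - conj_gp yp))"
    by (intro SUP_upper2[of xp]) auto
qed

lemma M_flat_sup_iff: "xp \<in> M_flat_sup K f \<tau>p \<tau>m gp gm \<longleftrightarrow> Fmax (blinfun_apply xp) gm - conj_gp xp = Fmax gp gm"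
  by (simp add: M_flat_sup_def P_flat_sup_eq P_flat_eq[OF legendre_fenchel_gp])

lemma E_sc_common_iff: "\<nu> \<in> E_sc_common K f \<tau>p \<tau>m gp gm xp \<longleftrightarrow>
    \<nu> \<in> D \<and> Fr (blinfun_apply xp) gm \<nu> = Fmax (blinfun_apply xp) gm"
  unfolding E_sc_common_eq_maximizers[OF legendre_fenchel_gp] maximizers_F_nl[OF continuous_on_dual lsc_gm]
  by simp

lemma E_sc_common_subset:
  assumes "xp \<in> M_flat_sup K f \<tau>p \<tau>m gp gm"
  shows "E_sc_common K f \<tau>p \<tau>m gp gm xp \<subseteq> {\<nu>\<in>K. xp \<in> subdifferential gp (\<tau>p \<nu>)}"
  using assms dual_maximizer(2) D_subset by (auto simp: E_sc_common_iff M_flat_sup_iff)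

text \<open>A maximizer belongs to the member given by any subgradient of \<open>gp\<close> at its
  image; the converse inclusion is \<open>dual_maximizer\<close>.\<close>

lemma maximizers_eq_Union:
  "maximizers K (F_nl f \<tau>p \<tau>m gp gm) =
    (\<Union>xp\<in>M_flat_sup K f \<tau>p \<tau>m gp gm. E_sc_common K f \<tau>p \<tau>m gp gm xp)"
proof (intro subset_antisym subsetI)
  fix \<nu> assume "\<nu> \<in> maximizers K (F_nl f \<tau>p \<tau>m gp gm)"
  then have \<nu>: "\<nu> \<in> D" "Fr gp gm \<nu> = Fmax gp gm"
    by (auto simp: maximizers_F_nl[OF continuous_gp lsc_gm])
  obtain xp where "xp \<in> subdifferential gp (\<tau>p \<nu>)"
    using convex_on_bounded_imp_subdifferential_nonempty[OF convex_gp bounded_gp] by blast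
  note maximizer_subgradient[OF \<nu> this]
  then show "\<nu> \<in> (\<Union>xp\<in>M_flat_sup K f \<tau>p \<tau>m gp gm. E_sc_common K f \<tau>p \<tau>m gp gm xp)"
    using \<nu>(1) by (auto simp: M_flat_sup_iff E_sc_common_iff)
next
  fix \<nu> assume "\<nu> \<in> (\<Union>xp\<in>M_flat_sup K f \<tau>p \<tau>m gp gm. E_sc_common K f \<tau>p \<tau>m gp gm xp)"
  then show "\<nu> \<in> maximizers K (F_nl f \<tau>p \<tau>m gp gm)"
    using dual_maximizer(1)
    by (auto simp: M_flat_sup_iff E_sc_common_iff maximizers_F_nl[OF continuous_gp lsc_gm])
qed

text \<open>Each maximizer of the nonlinear functional also maximizes some linearised one, whose
  only maximizer is an extreme point.\<close>

lemma maximizers_extreme: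
  assumes "ereal_affine_on K f" "\<And>xp xm. is_singleton (maximizers K (G_lin f \<tau>p \<tau>m xp xm))"
  shows "maximizers K (F_nl f \<tau>p \<tau>m gp gm) \<subseteq> {\<mu>. \<mu> extreme_point_of K}"
proof
  fix \<nu> assume "\<nu> \<in> maximizers K (F_nl f \<tau>p \<tau>m gp gm)"
  then obtain xp where xp: "\<nu> \<in> E_sc_common K f \<tau>p \<tau>m gp gm xp" unfolding maximizers_eq_Union by blast
  obtain xm where xm: "xm \<in> M_flat K f \<tau>p \<tau>m gp gm xp"
    using M_flat_nonempty[OF legendre_fenchel_gp] by blast
  then have "\<nu> \<in> E_sc K f \<tau>p \<tau>m gm xp xm"
    using xp by (simp add: E_sc_eq_maximizers[OF legendre_fenchel_gp] E_sc_common_eq_maximizers[OF legendre_fenchel_gp])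
  then have "\<nu> \<in> maximizers K (G_lin f \<tau>p \<tau>m xp xm)" by (simp add: E_sc_def)
  then show "\<nu> \<in> {\<mu>. \<mu> extreme_point_of K}"
    using singleton_maximizers_G_lin_extreme[OF assms] by simp
qed

text \<open>A common point of two members would have two different subgradients of \<open>gp\<close>
  at its image.\<close>

lemma disjoint_E_sc_common:
  assumes "gateaux_differentiable gp"
  shows "disjoint_family_on (E_sc_common K f \<tau>p \<tau>m gp gm) (M_flat_sup K f \<tau>p \<tau>m gp gm)"
  unfolding disjoint_family_on_def
  using E_sc_common_subset gateaux_differentiable_subgradient_unique[OF assms] by blast

end

theorem theorem3p8:
  fixes K :: "'v::{real_tvs, t2_space} set"
    and \<tau>p :: "'v \<Rightarrow> 'p::real_normed_vector" and \<tau>m :: "'v \<Rightarrow> 'm::real_normed_vector"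
    and f :: "'v \<Rightarrow> ereal" and gp :: "'p \<Rightarrow> real" and gm :: "'m \<Rightarrow> real"
  assumes "K \<noteq> {}" "compact K" "convex K"
    and "continuous_on K \<tau>p" "affine_map_on K \<tau>p"
    and "continuous_on K \<tau>m" "affine_map_on K \<tau>m"
    and "\<forall>\<mu>\<in>K. f \<mu> \<noteq> \<infinity>" "\<exists>\<mu>\<in>K. f \<mu> \<noteq> -\<infinity>"
    and "upper_semicontinuous_on K f" "ereal_concave_on K f"
    and "lower_semicontinuous_on UNIV gm" "convex_on UNIV gm"
    and "\<exists>R\<^sub>0>(0::real). \<forall>R\<ge>R\<^sub>0.
          cball 0 R \<inter> effective_domain (legendre_fenchel gm) \<noteq> {} \<and>
          closedin weak_star_topology (cball 0 R \<inter> effective_domain (legendre_fenchel gm))"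
    and "minimal_linear_growth (legendre_fenchel gm) (sup_norm_on K \<tau>m)"
    and "lower_semicontinuous_on UNIV gp" "convex_on UNIV gp"
    and "\<forall>B. bounded B \<longrightarrow> bounded (gp ` B)"
    and "effective_domain (legendre_fenchel gp) = UNIV"
    and "minimal_linear_growth (legendre_fenchel gp) (sup_norm_on K \<tau>p)"
  shows
    "((SUP \<mu>\<in>K. F_nl f \<tau>p \<tau>m gp gm \<mu>) = P_flat_sup K f \<tau>p \<tau>m gp gm \<and>
      P_flat_sup K f \<tau>p \<tau>m gp gm = (SUP yp. INF ym. P_NL K f \<tau>p \<tau>m gp gm yp ym) \<and>
      \<bar>P_flat_sup K f \<tau>p \<tau>m gp gm\<bar> \<noteq> \<infinity>)
   \<and>
     ((\<forall>xp\<in>M_flat_sup K f \<tau>p \<tau>m gp gm.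
         (\<forall>xm\<in>M_flat K f \<tau>p \<tau>m gp gm xp.
            E_sc K f \<tau>p \<tau>m gm xp xm \<noteq> {} \<and>
            convex (E_sc K f \<tau>p \<tau>m gm xp xm) \<and>
            compact (E_sc K f \<tau>p \<tau>m gm xp xm)) \<and>
         (\<forall>xm\<in>M_flat K f \<tau>p \<tau>m gp gm xp. \<forall>xm'\<in>M_flat K f \<tau>p \<tau>m gp gm xp.
            E_sc K f \<tau>p \<tau>m gm xp xm = E_sc K f \<tau>p \<tau>m gm xp xm') \<and>
         E_sc_common K f \<tau>p \<tau>m gp gm xp \<subseteq> {\<nu>\<in>K. xp \<in> subdifferential gp (\<tau>p \<nu>)}))
   \<and>
     (generalized_maximizers K (F_nl f \<tau>p \<tau>m gp gm) = maximizers K (F_nl f \<tau>p \<tau>m gp gm) \<and>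
      compact (maximizers K (F_nl f \<tau>p \<tau>m gp gm)) \<and>
      maximizers K (F_nl f \<tau>p \<tau>m gp gm) =
        (\<Union>xp\<in>M_flat_sup K f \<tau>p \<tau>m gp gm. E_sc_common K f \<tau>p \<tau>m gp gm xp) \<and>
      (gateaux_differentiable gp \<longrightarrow>
        disjoint_family_on (E_sc_common K f \<tau>p \<tau>m gp gm) (M_flat_sup K f \<tau>p \<tau>m gp gm)))
   \<and>
     (ereal_affine_on K f \<and>
      (\<forall>xp xm. is_singleton (maximizers K (G_lin f \<tau>p \<tau>m xp xm))) \<longrightarrow>
        generalized_maximizers K (F_nl f \<tau>p \<tau>m gp gm) = maximizers K (F_nl f \<tau>p \<tau>m gp gm) \<and>
        maximizers K (F_nl f \<tau>p \<tau>m gp gm) \<subseteq> {\<mu>. \<mu> extreme_point_of K})"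
proof -
  obtain R\<^sub>0 where "cball 0 R\<^sub>0 \<inter> effective_domain (legendre_fenchel gm) \<noteq> {}"
    using assms(14) by blast
  then have "effective_domain (legendre_fenchel gm) \<noteq> {}" by blast
  then interpret concave_minus_plus_convex K \<tau>p \<tau>m f gm gp
    using assms by unfold_locales
  have E_sc: "E_sc K f \<tau>p \<tau>m gm xp xm = maximizers K (F_nl f \<tau>p \<tau>m (blinfun_apply xp) gm)"
    if "xm \<in> M_flat K f \<tau>p \<tau>m gp gm xp" for xp xm
    by (rule E_sc_eq_maximizers[OF legendre_fenchel_gp that])
  have gen: "generalized_maximizers K (F_nl f \<tau>p \<tau>m gp gm) = maximizers K (F_nl f \<tau>p \<tau>m gp gm)"
    by (rule generalized_maximizers_eq_maximizers[OF upper_semicontinuous_on_F_nl[OF continuous_gp lsc_gm]])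
  show ?thesis
  proof (intro conjI ballI impI)
    show "(SUP \<mu>\<in>K. F_nl f \<tau>p \<tau>m gp gm \<mu>) = P_flat_sup K f \<tau>p \<tau>m gp gm"
      by (simp add: P_flat_sup_eq SUP_F_nl[OF continuous_gp lsc_gm])
    show "P_flat_sup K f \<tau>p \<tau>m gp gm = (SUP yp. INF ym. P_NL K f \<tau>p \<tau>m gp gm yp ym)"
      by (simp add: P_flat_sup_def P_flat_def)
    show "\<bar>P_flat_sup K f \<tau>p \<tau>m gp gm\<bar> \<noteq> \<infinity>" by (simp add: P_flat_sup_eq)
    \<comment> \<open>This equality occurs in two conjuncts of the goal, hence the
      repetition.\<close>
    show "generalized_maximizers K (F_nl f \<tau>p \<tau>m gp gm) = maximizers K (F_nl f \<tau>p \<tau>m gp gm)"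
      "generalized_maximizers K (F_nl f \<tau>p \<tau>m gp gm) = maximizers K (F_nl f \<tau>p \<tau>m gp gm)"
      by (fact gen)+
    show "compact (maximizers K (F_nl f \<tau>p \<tau>m gp gm))"
      by (rule compact_maximizers_F_nl[OF continuous_gp lsc_gm])
    show "maximizers K (F_nl f \<tau>p \<tau>m gp gm) =
        (\<Union>xp\<in>M_flat_sup K f \<tau>p \<tau>m gp gm. E_sc_common K f \<tau>p \<tau>m gp gm xp)"
      by (rule maximizers_eq_Union)
  next
    fix xp assume "xp \<in> M_flat_sup K f \<tau>p \<tau>m gp gm"
    then show "E_sc_common K f \<tau>p \<tau>m gp gm xp \<subseteq> {\<nu>\<in>K. xp \<in> subdifferential gp (\<tau>p \<nu>)}"
      by (rule E_sc_common_subset)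
  next
    fix xp xm assume "xm \<in> M_flat K f \<tau>p \<tau>m gp gm xp"
    note E_sc[OF this]
    then show "E_sc K f \<tau>p \<tau>m gm xp xm \<noteq> {}" "convex (E_sc K f \<tau>p \<tau>m gm xp xm)"
      "compact (E_sc K f \<tau>p \<tau>m gm xp xm)"
      by (simp_all add: maximizers_F_nl_nonempty[OF continuous_on_dual lsc_gm]
          convex_maximizers_F_nl compact_maximizers_F_nl[OF continuous_on_dual lsc_gm])
  next
    fix xp xm xm' assume "xm \<in> M_flat K f \<tau>p \<tau>m gp gm xp" "xm' \<in> M_flat K f \<tau>p \<tau>m gp gm xp"
    then show "E_sc K f \<tau>p \<tau>m gm xp xm = E_sc K f \<tau>p \<tau>m gm xp xm'" by (simp add: E_sc)
  next
    assume "gateaux_differentiable gp"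
    then show "disjoint_family_on (E_sc_common K f \<tau>p \<tau>m gp gm) (M_flat_sup K f \<tau>p \<tau>m gp gm)"
      by (rule disjoint_E_sc_common)
  next
    assume "ereal_affine_on K f \<and> (\<forall>xp xm. is_singleton (maximizers K (G_lin f \<tau>p \<tau>m xp xm)))"
    then show "maximizers K (F_nl f \<tau>p \<tau>m gp gm) \<subseteq> {\<mu>. \<mu> extreme_point_of K}"
      by (intro maximizers_extreme) auto
  qed
qed

end
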